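(* Let $F : (0,\infty) \to \mathbb{R}$ and let $d$ be a positive integer. The following are equivalent. (1) $F$ preserves total positivity entrywise on symmetric $d \times d$ matrices. (2) The function $F$ satisfies: (a) if $d = 1$: $F(x) > 0$ for all $x > 0$; (b) if $d = 2$: $F$ is positive, increasing, and multiplicatively mid-convex, that is, $F(\sqrt{xy})^2 \leq F(x)F(y)$ for all $x, y \in (0,\infty)$ (so $F$ is continuous); (c) if $d = 3$: $F(x) = c x^\alpha$ for some $c > 0$ and some $\alpha \geq 1$; (d) if $d = 4$: $F(x) = c x^\alpha$ for some $c > 0$ and some $\alpha \in \{1\} \cup [2,\infty)$; (e) if $d \geq 5$: $F(x) = cx$ for some $c > 0$.
   Context: A real matrix is totally positive if all of its minors (of every size) are positive. For a matrix $A = (a_{ij})$ with positive entries, $F[A] := (F(a_{ij}))$. "$F$ preserves total positivity entrywise on symmetric $d \times d$ matrices" means that $F[A]$ is totally positive whenever $A$ is a symmetric totally positive $d \times d$ matrix. "Increasing" means strictly increasing. *)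

theory Defs
  imports Complex_Main "Jordan_Normal_Form.Determinant" "Jordan_Normal_Form.DL_Submatrix"
begin

definition totally_positive :: "real mat \<Rightarrow> bool" where
  "totally_positive A \<longleftrightarrow>
     (\<forall>I J. I \<subseteq> {..<dim_row A} \<and> J \<subseteq> {..<dim_col A} \<and> I \<noteq> {} \<and> card I = card J
        \<longrightarrow> det (submatrix A I J) > 0)"

text \<open>The functions of interest live on the positive reals and are represented by total functions
  \<open>real \<Rightarrow> real\<close> whose values at nonpositive arguments play no role: the 1-by-1 minors of a totally
  positive matrix are its entries, so \<open>map_mat F A\<close> below only evaluates \<open>F\<close> at positive reals.\<close>

definition preserves_TP_symmetric :: "nat \<Rightarrow> (real \<Rightarrow> real) \<Rightarrow> bool" where
  "preserves_TP_symmetric d F \<longleftrightarrow>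
     (\<forall>A \<in> carrier_mat d d. transpose_mat A = A \<longrightarrow> totally_positive A
        \<longrightarrow> totally_positive (map_mat F A))"

definition mult_midconvex :: "(real \<Rightarrow> real) \<Rightarrow> bool" where
  "mult_midconvex F \<longleftrightarrow> (\<forall>x>0. \<forall>y>0. (F (sqrt (x * y)))\<^sup>2 \<le> F x * F y)"

end

(* Total positivity of a Gram-type matrix (sum of w_l phi_l phi_l^T) follows from Cauchy-Binet once the
   columns phi_l form a totally positive array, and such an array can always be enlarged, because a
   new entry in the bottom right corner only has to be large. This makes the property for d + 1 imply
   the one for d, and it lets low-rank kernels serve as limits of test matrices.

   Necessity. For d >= 3 every 2-by-2 totally positive matrix [x y; z w] sits off the diagonal of a
   symmetric totally positive 3-by-3 matrix, so F(y) F(z) < F(x) F(w) whenever y z < x w; with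
   continuity F / F(1) is multiplicative, hence a power. The exponents are cut down by the kernels
   1 + t x_i x_j (for d = 3, 4) and 1 + t <z_i, z_j> with five points z_i in the plane (for d = 5),
   letting t tend to 0.

   Sufficiency. A 3-by-3 minor with first row and column equal to 1 has powers with positive
   determinant because s |-> log ((1 + e^s)^alpha - 1) is convex for alpha >= 1. For symmetric 4-by-4
   matrices, positive definiteness survives powers alpha >= 2 by FitzGerald and Horn. *)
theory Submission
  imports Defs "HOL-Real_Asymp.Real_Asymp"
begin

section \<open>Minors indexed by increasing selections\<close>

text \<open>What separates sizes 4 and 5 is the shape of the minors. In a 4-by-4 array every minor
  other than the full determinant has size at most 3, where each exponent
  \<open>\<alpha> \<ge> 1\<close> works without symmetry; only the full determinant, which is
  principal, calls for positive definiteness. In size 5 there are non-principal 4-by-4 minors, about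
  which quadratic forms say nothing, while large exponents do preserve 5-by-5 positive definiteness.
  So the case of size 5 has to exhibit a bad minor directly. The kernel 1 + t x y cannot supply one
  for \<alpha> > 2: its power is the sum of binom(\<alpha>,k) t^k x^k y^k, and the lowest term in t
  of a 4-by-4 minor is binom(\<alpha>,1) binom(\<alpha>,2) binom(\<alpha>,3) times two Vandermonde
  determinants, which is positive. In the plane the quadratic monomials u^2, u v, v^2 enter with the
  same power of t, and their combined contribution can be negative. All limits yield weak
  inequalities only. This suffices, since the leading coefficient is strictly negative for each
  excluded exponent.\<close>

definition kdet :: "nat \<Rightarrow> (nat \<Rightarrow> nat \<Rightarrow> real) \<Rightarrow> real" where
  "kdet k f = det (mat k k (\<lambda>(i, j). f i j))"

lemma kdet_cong:
  "(\<And>i j. i < k \<Longrightarrow> j < k \<Longrightarrow> f i j = g i j) \<Longrightarrow> kdet k f = kdet k g"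
  unfolding kdet_def by (rule arg_cong[where f = det]) (auto intro!: eq_matI)

lemma kdet_leibniz:
  "kdet k f = (\<Sum>p | p permutes {0..<k}. signof p * (\<Prod>i = 0..<k. f i (p i)))"
proof -
  have "kdet k f = (\<Sum>p | p permutes {0..<k}.
      signof p * (\<Prod>i = 0..<k. mat k k (\<lambda>(i, j). f i j) $$ (i, p i)))"
    unfolding kdet_def by (rule det_def') simp
  also have "\<dots> = (\<Sum>p | p permutes {0..<k}. signof p * (\<Prod>i = 0..<k. f i (p i)))"
  proof (intro sum.cong refl arg_cong2[where f = "(*)"] prod.cong)
    fix p i assume "p \<in> {p. p permutes {0..<k}}" "i \<in> {0..<k}"
    then have "p i \<in> {0..<k}" by (auto simp: permutes_in_image)
    then show "mat k k (\<lambda>(i, j). f i j) $$ (i, p i) = f i (p i)"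
      using \<open>i \<in> {0..<k}\<close> by simp
  qed
  finally show ?thesis .
qed

lemma kdet_0 [simp]: "kdet 0 f = 1"
  unfolding kdet_def by (simp add: det_dim_zero)

lemma kdet_transpose: "kdet k (\<lambda>i j. f j i) = kdet k f"
proof -
  have "mat k k (\<lambda>(i, j). f j i) = (mat k k (\<lambda>(i, j). f i j))\<^sup>T"
    by (auto intro!: eq_matI)
  then show ?thesis
    unfolding kdet_def by (simp add: det_transpose[of _ k])
qed

lemma kdet_scale:
  "kdet k (\<lambda>i j. r i * s j * f i j) = (\<Prod>i<k. r i) * (\<Prod>i<k. s i) * kdet k f"
proof -
  have "(\<Prod>i = 0..<k. r i * s (p i) * f i (p i)) =
      (\<Prod>i<k. r i) * (\<Prod>i<k. s i) * (\<Prod>i = 0..<k. f i (p i))"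
    if "p permutes {0..<k}" for p
  proof -
    have "(\<Prod>i = 0..<k. s (p i)) = (\<Prod>i = 0..<k. s i)"
      using that by (rule prod.permute[symmetric, unfolded o_def])
    then show ?thesis by (simp add: prod.distrib atLeast0LessThan)
  qed
  then have "(\<Sum>p | p permutes {0..<k}. signof p * (\<Prod>i = 0..<k. r i * s (p i) * f i (p i))) =
      (\<Sum>p | p permutes {0..<k}. (\<Prod>i<k. r i) * (\<Prod>i<k. s i) *
        (signof p * (\<Prod>i = 0..<k. f i (p i))))"
    by (intro sum.cong refl) (simp only: mem_Collect_eq mult.left_commute)
  then show ?thesis
    unfolding kdet_leibniz sum_distrib_left .
qed

lemma tendsto_kdet:
  assumes "\<And>i j. i < k \<Longrightarrow> j < k \<Longrightarrow> ((\<lambda>x. f x i j) \<longlongrightarrow> g i j) F"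
  shows "((\<lambda>x. kdet k (f x)) \<longlongrightarrow> kdet k g) F"
  unfolding kdet_leibniz
proof (intro tendsto_sum tendsto_mult tendsto_const tendsto_prod)
  fix p i assume "p \<in> {p. p permutes {0..<k}}" "i \<in> {0..<k}"
  moreover from this have "p i \<in> {0..<k}" by (auto simp: permutes_in_image)
  ultimately show "((\<lambda>x. f x i (p i)) \<longlongrightarrow> g i (p i)) F" by (auto intro: assms)
qed

lemma kdet_Suc_first_row:
  "kdet (Suc k) f =
     (\<Sum>j<Suc k. (- 1) ^ j * f 0 j * kdet k (\<lambda>i l. f (Suc i) (if l < j then l else Suc l)))"
proof -
  let ?A = "mat (Suc k) (Suc k) (\<lambda>(i, j). f i j)"
  have "det (mat_delete ?A 0 j) = kdet k (\<lambda>i l. f (Suc i) (if l < j then l else Suc l))"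
    if "j < Suc k" for j
    unfolding kdet_def mat_delete_def
    by (rule arg_cong[where f = det]) (auto intro!: eq_matI)
  then show ?thesis
    unfolding kdet_def[of "Suc k"]
    by (subst laplace_expansion_row[of _ "Suc k" 0])
      (auto simp: cofactor_def mult_ac simp del: sum.lessThan_Suc intro!: sum.cong)
qed

text \<open>Laplace expansion along the last row: the cofactors do not see that row, so zeroing the
  corner changes a single term, whose cofactor is the leading minor. A minor is thus affine in its
  corner entry.\<close>

lemma kdet_Suc_corner:
  "kdet (Suc k) f =
     f k k * kdet k f + kdet (Suc k) (\<lambda>i j. if i = k \<and> j = k then 0 else f i j)"
proof -
  let ?A = "mat (Suc k) (Suc k) (\<lambda>(i, j). f i j)"
  let ?B = "mat (Suc k) (Suc k) (\<lambda>(i, j). if i = k \<and> j = k then 0 else f i j)"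
  have c: "cofactor ?A k j = cofactor ?B k j" if "j < Suc k" for j
    unfolding cofactor_def mat_delete_def
    by (intro arg_cong2[where f = "(*)"] arg_cong[where f = det] refl) (auto intro!: eq_matI)
  have ck: "cofactor ?A k k = kdet k f"
    unfolding cofactor_def mat_delete_def kdet_def
    by (simp add: power_add[symmetric] mult_2[symmetric], rule arg_cong[where f = det])
      (auto intro!: eq_matI)
  have "det ?A = (\<Sum>j<Suc k. ?A $$ (k, j) * cofactor ?A k j)"
    by (rule laplace_expansion_row) auto
  also have "\<dots> = (\<Sum>j<k. ?A $$ (k, j) * cofactor ?A k j) + f k k * kdet k f"
    by (simp add: ck)
  also have "(\<Sum>j<k. ?A $$ (k, j) * cofactor ?A k j) = (\<Sum>j<Suc k. ?B $$ (k, j) * cofactor ?B k j)"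
    by (simp add: c)
  also have "\<dots> = det ?B"
    by (rule laplace_expansion_row[symmetric]) auto
  finally show ?thesis unfolding kdet_def by simp
qed

lemma kdet_1 [simp]: "kdet (Suc 0) f = f 0 0"
  by (simp add: kdet_Suc_first_row)

lemma kdet_2: "kdet 2 f = f 0 0 * f 1 1 - f 0 1 * f 1 0"
  by (simp add: numeral_2_eq_2 kdet_Suc_first_row)

lemma kdet_3:
  "kdet 3 f = f 0 0 * (f 1 1 * f 2 2 - f 1 2 * f 2 1)
     - f 0 1 * (f 1 0 * f 2 2 - f 1 2 * f 2 0) + f 0 2 * (f 1 0 * f 2 1 - f 1 1 * f 2 0)"
proof -
  have S: "(\<Sum>j<Suc 2. h j) = h 0 + h 1 + h 2" for h :: "nat \<Rightarrow> real"
    by (simp add: numeral_2_eq_2)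
  have n: "Suc 1 = 2" by simp
  have "kdet 3 f = kdet (Suc 2) f" by (simp add: numeral_3_eq_3 numeral_2_eq_2)
  then show ?thesis
    unfolding kdet_Suc_first_row S kdet_2 n One_nat_def[symmetric] by simp
qed

lemma kdet_identical_columns:
  assumes "i < k" "j < k" "i \<noteq> j" "\<And>l. l < k \<Longrightarrow> f l i = f l j"
  shows "kdet k f = 0"
  unfolding kdet_def
  by (rule det_identical_columns[of _ k i j]) (use assms in \<open>auto intro!: eq_vecI\<close>)

text \<open>Increasing index maps instead of index sets, so that a minor of a submatrix arises by
  composing maps. Values at arguments from \<open>k\<close> on are unconstrained, hence many maps
  describe the same minor.\<close>

definition selects :: "nat \<Rightarrow> nat \<Rightarrow> (nat \<Rightarrow> nat) \<Rightarrow> bool" where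
  "selects k n p \<longleftrightarrow> (\<forall>i<k. p i < n) \<and> (\<forall>i j. i < j \<longrightarrow> j < k \<longrightarrow> p i < p j)"

text \<open>Only the \<open>m\<close>-by-\<open>n\<close> corner of an infinite array is inspected,
  so bordering a matrix means overwriting entries. The empty minor is 1, and sizes beyond
  \<open>m\<close> or \<open>n\<close> admit no selection.\<close>

definition TP :: "(nat \<Rightarrow> nat \<Rightarrow> real) \<Rightarrow> nat \<Rightarrow> nat \<Rightarrow> bool" where
  "TP a m n \<longleftrightarrow>
     (\<forall>k p q. selects k m p \<longrightarrow> selects k n q \<longrightarrow> kdet k (\<lambda>i j. a (p i) (q j)) > 0)"

lemma TP_D: "TP a m n \<Longrightarrow> selects k m p \<Longrightarrow> selects k n q \<Longrightarrow> kdet k (\<lambda>i j. a (p i) (q j)) > 0"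
  unfolding TP_def by blast

lemma TP_I:
  assumes "\<And>k p q. k > 0 \<Longrightarrow> selects k m p \<Longrightarrow> selects k n q \<Longrightarrow> kdet k (\<lambda>i j. a (p i) (q j)) > 0"
  shows "TP a m n"
  unfolding TP_def
proof (intro allI impI)
  fix k p q assume "selects k m p" "selects k n q"
  then show "kdet k (\<lambda>i j. a (p i) (q j)) > 0" by (cases "k = 0") (simp_all add: assms)
qed

lemma selects_ge: "selects k n p \<Longrightarrow> i < k \<Longrightarrow> i \<le> p i"
proof (induction i)
  case (Suc i)
  then have "p i < p (Suc i)" by (simp add: selects_def)
  moreover have "i \<le> p i" using Suc by simp
  ultimately show ?case by simp
qed simp

lemma selects_le: "selects k n p \<Longrightarrow> k \<le> n"
proof (cases k)
  case (Suc l)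
  assume "selects k n p"
  then have "l \<le> p l" "p l < n" using Suc selects_ge[of k n p l] unfolding selects_def by simp_all
  then show ?thesis using Suc by simp
qed simp

lemma selects_id: "k \<le> n \<Longrightarrow> selects k n (\<lambda>i. i)"
  unfolding selects_def by auto

lemma selects_inj: "selects k n p \<Longrightarrow> inj_on p {..<k}"
  unfolding selects_def inj_on_def by (metis lessThan_iff nat_neq_iff)

lemma selects_mono: "selects k n p \<Longrightarrow> n \<le> n' \<Longrightarrow> selects k n' p"
  unfolding selects_def by auto

lemma selects_full: "selects k k p \<Longrightarrow> i < k \<Longrightarrow> p i = i"
proof (induction k arbitrary: i)
  case (Suc k)
  have pk: "p k = k"
  proof (rule antisym)
    show "p k \<le> k" using Suc.prems(1) unfolding selects_def by (simp add: less_Suc_eq_le)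
    show "k \<le> p k" using selects_ge[OF Suc.prems(1), of k] by simp
  qed
  then have "selects k k p"
    using Suc.prems(1) unfolding selects_def by (metis lessI less_SucI)
  then show ?case using Suc pk by (auto simp: less_Suc_eq)
qed simp

lemma pick_selects:
  assumes "I \<subseteq> {..<n}"
  shows "selects (card I) n (pick I)"
  unfolding selects_def
proof (intro conjI allI impI)
  fix i assume "i < card I"
  then show "pick I i < n" using pick_in_set_le[of i I] assms by blast
next
  fix i j assume "i < j" "j < card I"
  then show "pick I i < pick I j" by (rule pick_mono_le[rotated])
qed

lemma pick_image:
  assumes "finite I"
  shows "pick I ` {..<card I} = I"
proof (rule card_subset_eq[OF assms])
  show "pick I ` {..<card I} \<subseteq> I" 
  proof (rule image_subsetI)
    fix i assume "i \<in> {..<card I}"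
    then show "pick I i \<in> I" unfolding lessThan_iff by (rule pick_in_set_le)
  qed
  obtain n where "I \<subseteq> {..<n}" using assms finite_nat_bounded by blast
  then have "inj_on (pick I) {..<card I}" by (rule selects_inj[OF pick_selects])
  then show "card (pick I ` {..<card I}) = card I" by (simp add: card_image)
qed

lemma selects_unique:
  assumes "selects k n p" "selects k n' q" "p ` {..<k} = q ` {..<k}" "i < k"
  shows "p i = q i"
proof -
  have *: "sorted_wrt (<) (map p [0..<k])" if "selects k n p" for n p
    unfolding sorted_wrt_iff_nth_less
  proof (intro allI impI)
    fix i j assume "i < j" "j < length (map p [0..<k])"
    then show "map p [0..<k] ! i < map p [0..<k] ! j" using that by (simp add: selects_def)
  qed
  have "map p [0..<k] = map q [0..<k]"
    by (rule strict_sorted_equal[OF *[OF assms(2)] *[OF assms(1)]])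
      (simp add: atLeast0LessThan assms(3))
  then show ?thesis using assms(4) unfolding map_eq_conv by simp
qed

lemma selects_pick:
  assumes "selects k n p" "i < k"
  shows "pick (p ` {..<k}) i = p i"
proof -
  let ?I = "p ` {..<k}"
  have c: "card ?I = k" using selects_inj[OF assms(1)] by (rule card_image[THEN trans]) simp
  have "?I \<subseteq> {..<n}" using assms(1) unfolding selects_def by blast
  then have s: "selects k n (pick ?I)" using pick_selects[of ?I n] unfolding c by simp
  have "pick ?I ` {..<k} = ?I" using pick_image[of ?I] unfolding c by simp
  then show ?thesis by (rule selects_unique[OF s assms(1) _ assms(2)])
qed

text \<open>\<open>submatrix\<close> enumerates the chosen rows and columns by \<open>pick\<close>,
  which is increasing; conversely every selection is the \<open>pick\<close> of its own image, by
  \<open>selects_pick\<close>.\<close>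

lemma totally_positive_iff_TP:
  "totally_positive A \<longleftrightarrow> TP (\<lambda>i j. A $$ (i, j)) (dim_row A) (dim_col A)"
proof
  assume A: "totally_positive A"
  show "TP (\<lambda>i j. A $$ (i, j)) (dim_row A) (dim_col A)"
  proof (rule TP_I)
    fix k p q assume k: "k > 0" and p: "selects k (dim_row A) p" and q: "selects k (dim_col A) q"
    define I J where "I = p ` {..<k}" and "J = q ` {..<k}"
    have IJ: "I \<subseteq> {..<dim_row A}" "J \<subseteq> {..<dim_col A}" "I \<noteq> {}" "card I = k" "card J = k"
      using k p q selects_inj[OF p, THEN card_image] selects_inj[OF q, THEN card_image]
      unfolding I_def J_def selects_def by (blast, blast, blast, simp_all)
    have s: "{i. i < dim_row A \<and> i \<in> I} = I" "{i. i < dim_col A \<and> i \<in> J} = J" using IJ(1,2) by auto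
    have "det (submatrix A I J) > 0" 
      using A[unfolded totally_positive_def, rule_format, of I J] IJ by simp
    also have "det (submatrix A I J) = kdet k (\<lambda>i j. A $$ (pick I i, pick J j))"
      unfolding submatrix_def kdet_def s IJ(4,5) ..
    also have "\<dots> = kdet k (\<lambda>i j. A $$ (p i, q j))"
      by (rule kdet_cong) (simp add: I_def J_def selects_pick[OF p] selects_pick[OF q])
    finally show "kdet k (\<lambda>i j. A $$ (p i, q j)) > 0" .
  qed
next
  assume A: "TP (\<lambda>i j. A $$ (i, j)) (dim_row A) (dim_col A)"
  show "totally_positive A"
    unfolding totally_positive_def
  proof (intro allI impI, elim conjE)
    fix I J assume IJ: "I \<subseteq> {..<dim_row A}" "J \<subseteq> {..<dim_col A}" "I \<noteq> {}" "card I = card J"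
    have s: "{i. i < dim_row A \<and> i \<in> I} = I" "{i. i < dim_col A \<and> i \<in> J} = J" using IJ(1,2) by auto
    have "kdet (card I) (\<lambda>i j. A $$ (pick I i, pick J j)) > 0"
      using pick_selects[OF IJ(2)] unfolding IJ(4)[symmetric]
      by (rule TP_D[OF A pick_selects[OF IJ(1)]])
    then show "det (submatrix A I J) > 0"
      unfolding submatrix_def kdet_def s IJ(4) .
  qed
qed

lemma TP_cong_imp:
  assumes "TP a m n" "\<And>i j. i < m \<Longrightarrow> j < n \<Longrightarrow> a i j = b i j"
  shows "TP b m n"
proof (rule TP_I)
  fix k p q assume p: "selects k m p" and q: "selects k n q"
  have "kdet k (\<lambda>i j. b (p i) (q j)) = kdet k (\<lambda>i j. a (p i) (q j))"
    using p q by (intro kdet_cong assms(2)[symmetric]) (simp_all add: selects_def)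
  then show "kdet k (\<lambda>i j. b (p i) (q j)) > 0" using TP_D[OF assms(1) p q] by simp
qed

lemma preserves_TP_symmetric_iff:
  "preserves_TP_symmetric d F \<longleftrightarrow>
     (\<forall>a. (\<forall>i j. a i j = a j i) \<longrightarrow> TP a d d \<longrightarrow> TP (\<lambda>i j. F (a i j)) d d)"
proof (intro iffI allI impI)
  fix a :: "nat \<Rightarrow> nat \<Rightarrow> real"
  assume F: "preserves_TP_symmetric d F" and a: "\<forall>i j. a i j = a j i" "TP a d d"
  let ?A = "mat d d (\<lambda>(i, j). a i j)"
  have "TP (\<lambda>i j. ?A $$ (i, j)) d d" by (rule TP_cong_imp[OF a(2)]) simp
  then have "totally_positive ?A" by (simp add: totally_positive_iff_TP)
  moreover have "transpose_mat ?A = ?A"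
  proof (rule eq_matI)
    fix i j assume "i < dim_row ?A" "j < dim_col ?A"
    then show "transpose_mat ?A $$ (i, j) = ?A $$ (i, j)" using a(1) by simp
  qed simp_all
  ultimately have "totally_positive (map_mat F ?A)"
    using F unfolding preserves_TP_symmetric_def by simp
  then have "TP (\<lambda>i j. map_mat F ?A $$ (i, j)) d d" by (simp add: totally_positive_iff_TP)
  then show "TP (\<lambda>i j. F (a i j)) d d" by (rule TP_cong_imp) simp
next
  assume *: "\<forall>a. (\<forall>i j. a i j = a j i) \<longrightarrow> TP a d d \<longrightarrow> TP (\<lambda>i j. F (a i j)) d d"
  show "preserves_TP_symmetric d F"
    unfolding preserves_TP_symmetric_def
  proof (intro ballI impI)
    fix A :: "real mat" assume A: "A \<in> carrier_mat d d" "transpose_mat A = A" "totally_positive A"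
    \<comment> \<open>The reformulation asks for symmetry at all indices; padding with 0 outside the
      \<open>d\<close>-by-\<open>d\<close> block provides it.\<close>
    define a where "a i j = (if i < d \<and> j < d then A $$ (i, j) else 0)" for i j
    have "A $$ (i, j) = A $$ (j, i)" if "i < d" "j < d" for i j
    proof -
      have "A $$ (i, j) = transpose_mat A $$ (i, j)" by (simp only: A(2))
      then show ?thesis using A(1) that by simp
    qed
    then have "\<forall>i j. a i j = a j i" by (simp add: a_def)
    moreover have "TP (\<lambda>i j. A $$ (i, j)) d d"
      using A by (simp add: totally_positive_iff_TP)
    then have "TP a d d" by (rule TP_cong_imp) (simp add: a_def)
    ultimately have "TP (\<lambda>i j. F (a i j)) d d" using * by blast
    then have "TP (\<lambda>i j. map_mat F A $$ (i, j)) d d"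
      by (rule TP_cong_imp) (use A(1) in \<open>simp add: a_def\<close>)
    then show "totally_positive (map_mat F A)" using A(1) by (simp add: totally_positive_iff_TP)
  qed
qed

section \<open>The Cauchy-Binet formula and extension of totally positive arrays\<close>

lemma kdet_permute_rows:
  assumes "p permutes {0..<k}"
  shows "kdet k (\<lambda>i j. f (p i) j) = signof p * kdet k f"
proof -
  let ?A = "mat k k (\<lambda>(i, j). f i j)"
  have "p i < k" if "i < k" for i
    using permutes_in_image[OF assms, of i] that by simp
  then have "mat k k (\<lambda>(i, j). f (p i) j) = mat k k (\<lambda>(i, j). ?A $$ (p i, j))"
    by (intro eq_matI) simp_all
  then show ?thesis
    unfolding kdet_def using det_permute_rows[of ?A k p] assms by simp
qed

text \<open>Multilinearity in the rows: distributing the Leibniz products over the sums chooses one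
  \<open>l = h i\<close> for each row \<open>i\<close>.\<close>

lemma kdet_mult_expand:
  fixes n :: nat
  shows
  "kdet k (\<lambda>i j. \<Sum>l<n. f i l * g j l) =
     (\<Sum>h\<in>{0..<k} \<rightarrow>\<^sub>E {..<n}. (\<Prod>i = 0..<k. f i (h i)) * kdet k (\<lambda>i j. g j (h i)))"
proof -
  have "kdet k (\<lambda>i j. \<Sum>l<n. f i l * g j l) =
      (\<Sum>p | p permutes {0..<k}. \<Sum>h\<in>{0..<k} \<rightarrow>\<^sub>E {..<n}.
        (\<Prod>i = 0..<k. f i (h i)) * (signof p * (\<Prod>i = 0..<k. g (p i) (h i))))"
    unfolding kdet_leibniz
    by (subst prod_sum_PiE) (simp_all add: sum_distrib_left prod.distrib mult_ac)
  also have "\<dots> = (\<Sum>h\<in>{0..<k} \<rightarrow>\<^sub>E {..<n}.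
      (\<Prod>i = 0..<k. f i (h i)) * kdet k (\<lambda>i j. g j (h i)))"
    unfolding kdet_leibniz sum_distrib_left by (rule sum.swap)
  finally show ?thesis .
qed

text \<open>In the expansion over choice functions, a non-injective \<open>h\<close> repeats a row
  and contributes 0. The injective ones are grouped by their image \<open>S\<close>; within a group,
  \<open>h\<close> is \<open>pick S\<close> after a permutation, and the signs and products of these
  permutations rebuild the Leibniz formula of the first minor.\<close>

theorem Cauchy_Binet:
  fixes n :: nat
  shows
  "kdet k (\<lambda>i j. \<Sum>l<n. f i l * g j l) =
     (\<Sum>S | S \<subseteq> {..<n} \<and> card S = k.
        kdet k (\<lambda>i j. f i (pick S j)) * kdet k (\<lambda>i j. g i (pick S j)))"
proof -
  define H where "H = {h \<in> {0..<k} \<rightarrow>\<^sub>E {..<n}. inj_on h {0..<k}}"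
  define T where "T = {S. S \<subseteq> {..<n} \<and> card S = k}"
  define \<Phi> where "\<Phi> h = (\<Prod>i = 0..<k. f i (h i)) * kdet k (\<lambda>i j. g j (h i))" for h
  have finP: "finite ({0..<k} \<rightarrow>\<^sub>E {..<n})" by (intro finite_PiE) simp_all
  have finT: "finite T" unfolding T_def by simp
  have "kdet k (\<lambda>i j. \<Sum>l<n. f i l * g j l) = sum \<Phi> ({0..<k} \<rightarrow>\<^sub>E {..<n})"
    unfolding \<Phi>_def by (rule kdet_mult_expand)
  also have "\<dots> = sum \<Phi> H"
  proof (rule sum.mono_neutral_right[OF finP])
    show "H \<subseteq> {0..<k} \<rightarrow>\<^sub>E {..<n}" unfolding H_def by blast
    show "\<forall>h\<in>({0..<k} \<rightarrow>\<^sub>E {..<n}) - H. \<Phi> h = 0"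
    proof
      fix h assume "h \<in> ({0..<k} \<rightarrow>\<^sub>E {..<n}) - H"
      then obtain i j where "i < k" "j < k" "i \<noteq> j" "h i = h j"
        unfolding H_def inj_on_def by auto
      then have "kdet k (\<lambda>i j. g i (h j)) = 0" by (intro kdet_identical_columns[of i k j]) simp_all
      then show "\<Phi> h = 0" unfolding \<Phi>_def by (simp add: kdet_transpose[of k "\<lambda>i j. g i (h j)"])
    qed
  qed
  also have "\<dots> = (\<Sum>S\<in>T. sum \<Phi> {h \<in> H. h ` {0..<k} = S})"
  proof (rule sum.group[symmetric])
    show "finite H" unfolding H_def using finP by simp
    show "(\<lambda>h. h ` {0..<k}) ` H \<subseteq> T"
      unfolding H_def T_def by (auto simp: card_image)
  qed (rule finT)
  also have "\<dots> = (\<Sum>S\<in>T. kdet k (\<lambda>i j. f i (pick S j)) * kdet k (\<lambda>i j. g i (pick S j)))"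
  proof (rule sum.cong[OF refl])
    fix S assume "S \<in> T"
    then have S: "S \<subseteq> {..<n}" "card S = k" unfolding T_def by auto
    have finS: "finite S" using S(1) finite_subset by blast
    define e where "e = pick S"
    have e: "bij_betw e {0..<k} S"
      unfolding bij_betw_def e_def atLeast0LessThan S(2)[symmetric]
      using pick_image[OF finS] selects_inj[OF pick_selects[OF S(1)]] by simp
    \<comment> \<open>Members of \<open>H\<close> are extensional, so \<open>pick S\<close> after
      \<open>\<sigma>\<close> has to be cut off outside \<open>{0..<k}\<close>.\<close>
    define R where "R \<sigma> = restrict (\<lambda>i. e (\<sigma> i)) {0..<k}" for \<sigma> :: "nat \<Rightarrow> nat"
    have R1: "inj_on R {\<sigma>. \<sigma> permutes {0..<k}}"
      proof (rule inj_onI)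
        fix \<sigma> \<tau> assume st: "\<sigma> \<in> {\<sigma>. \<sigma> permutes {0..<k}}" "\<tau> \<in> {\<sigma>. \<sigma> permutes {0..<k}}" "R \<sigma> = R \<tau>"
        show "\<sigma> = \<tau>"
        proof
          fix i show "\<sigma> i = \<tau> i"
          proof (cases "i < k")
            case True
            have "R \<sigma> i = R \<tau> i" by (simp only: st(3))
            then have "e (\<sigma> i) = e (\<tau> i)" using True by (simp add: R_def)
            moreover have "\<sigma> i \<in> {0..<k}" "\<tau> i \<in> {0..<k}"
              using st(1,2) True by (simp_all add: permutes_in_image)
            ultimately show ?thesis using e by (meson bij_betw_def inj_on_def)
          next
            case False
            then show ?thesis using st(1,2) by (simp add: permutes_not_in)
          qed
        qed
      qed
    have R2: "h \<in> {h \<in> H. h ` {0..<k} = S}" if h': "h \<in> R ` {\<sigma>. \<sigma> permutes {0..<k}}" for h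
    proof -
      obtain \<sigma> where s: "\<sigma> permutes {0..<k}" and h: "h = R \<sigma>" using h' by blast
      have "bij_betw (e \<circ> \<sigma>) {0..<k} S"
        using permutes_imp_bij[OF s] e by (rule bij_betw_trans)
      then have "bij_betw h {0..<k} S"
        using bij_betw_cong[of "{0..<k}" "e \<circ> \<sigma>" h S] by (simp add: h R_def)
      moreover have "h \<in> {0..<k} \<rightarrow>\<^sub>E {..<n}"
        using \<open>bij_betw h {0..<k} S\<close> S(1) unfolding h R_def bij_betw_def by auto
      ultimately show ?thesis
        unfolding H_def bij_betw_def by blast
    qed
    have R3: "h \<in> R ` {\<sigma>. \<sigma> permutes {0..<k}}" if h: "h \<in> {h \<in> H. h ` {0..<k} = S}" for h
    proof -
      have hb: "bij_betw h {0..<k} S" and hE: "h \<in> {0..<k} \<rightarrow>\<^sub>E {..<n}"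
        using h unfolding H_def bij_betw_def by auto
      define \<sigma> where "\<sigma> i = (if i < k then inv_into {0..<k} e (h i) else i)" for i
      have "bij_betw (inv_into {0..<k} e \<circ> h) {0..<k} {0..<k}"
        using hb bij_betw_inv_into[OF e] by (rule bij_betw_trans)
      moreover have "bij_betw (inv_into {0..<k} e \<circ> h) {0..<k} {0..<k} = bij_betw \<sigma> {0..<k} {0..<k}"
        by (rule bij_betw_cong) (simp add: \<sigma>_def)
      ultimately have "bij_betw \<sigma> {0..<k} {0..<k}" by simp
      then have s: "\<sigma> permutes {0..<k}"
        by (rule bij_imp_permutes) (simp add: \<sigma>_def)
      have "R \<sigma> = h"
      proof
        fix i show "R \<sigma> i = h i"
        proof (cases "i < k")
          case True
          then have "h i \<in> S" using hb unfolding bij_betw_def by auto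
          then show ?thesis
            using True bij_betw_inv_into_right[OF e, of "h i"] by (simp add: R_def \<sigma>_def)
        next
          case False
          then show ?thesis using PiE_arb[OF hE, of i] by (simp add: R_def)
        qed
      qed
      then show ?thesis using s by blast
    qed
    have R: "bij_betw R {\<sigma>. \<sigma> permutes {0..<k}} {h \<in> H. h ` {0..<k} = S}"
      by (intro bij_betw_imageI R1 subset_antisym subsetI) (fact R2, fact R3)
    have "sum \<Phi> {h \<in> H. h ` {0..<k} = S} = (\<Sum>\<sigma> | \<sigma> permutes {0..<k}. \<Phi> (R \<sigma>))"
      by (rule sum.reindex_bij_betw[OF R, symmetric])
    also have "\<dots> = (\<Sum>\<sigma> | \<sigma> permutes {0..<k}.
        (signof \<sigma> * (\<Prod>i = 0..<k. f i (e (\<sigma> i)))) * kdet k (\<lambda>i j. g i (e j)))"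
    proof (rule sum.cong[OF refl])
      fix \<sigma> assume "\<sigma> \<in> {\<sigma>. \<sigma> permutes {0..<k}}"
      then have s: "\<sigma> permutes {0..<k}" by blast
      have "kdet k (\<lambda>i j. g j (R \<sigma> i)) = kdet k (\<lambda>i j. g j (e (\<sigma> i)))"
        by (rule kdet_cong) (simp add: R_def)
      also have "\<dots> = signof \<sigma> * kdet k (\<lambda>i j. g j (e i))"
        by (rule kdet_permute_rows[OF s])
      also have "kdet k (\<lambda>i j. g j (e i)) = kdet k (\<lambda>i j. g i (e j))"
        by (rule kdet_transpose)
      finally show "\<Phi> (R \<sigma>) = (signof \<sigma> * (\<Prod>i = 0..<k. f i (e (\<sigma> i)))) * kdet k (\<lambda>i j. g i (e j))"
        by (simp add: \<Phi>_def R_def)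
    qed
    also have "\<dots> = kdet k (\<lambda>i j. f i (e j)) * kdet k (\<lambda>i j. g i (e j))"
      unfolding kdet_leibniz[of k "\<lambda>i j. f i (e j)"] sum_distrib_right ..
    finally show "sum \<Phi> {h \<in> H. h ` {0..<k} = S} =
        kdet k (\<lambda>i j. f i (pick S j)) * kdet k (\<lambda>i j. g i (pick S j))"
      unfolding e_def .
  qed
  finally show ?thesis unfolding T_def .
qed

lemma TP_gram:
  assumes "TP \<phi> m n" "m \<le> n" "\<And>l. l < n \<Longrightarrow> w l > 0"
  shows "TP (\<lambda>i j. \<Sum>l<n. w l * \<phi> i l * \<phi> j l) m m"
proof (rule TP_I)
  fix k p q assume p: "selects k m p" and q: "selects k m q"
  let ?T = "{S. S \<subseteq> {..<n} \<and> card S = k}"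
  have "kdet k (\<lambda>i j. \<Sum>l<n. w l * \<phi> (p i) l * \<phi> (q j) l) =
      (\<Sum>S\<in>?T. kdet k (\<lambda>i j. w (pick S j) * \<phi> (p i) (pick S j)) * kdet k (\<lambda>i j. \<phi> (q i) (pick S j)))"
    by (rule Cauchy_Binet)
  also have "\<dots> > 0"
  proof (rule sum_pos)
    show "finite ?T" by simp
    \<comment> \<open>Strict positivity requires at least one summand; this is where
      \<open>m \<le> n\<close> enters.\<close>
    have "{..<k} \<in> ?T" using selects_le[OF p] assms(2) by auto
    then show "?T \<noteq> {}" by blast
    fix S assume "S \<in> ?T"
    then have S: "selects k n (pick S)" using pick_selects[of S n] by auto
    have "kdet k (\<lambda>i j. w (pick S j) * \<phi> (p i) (pick S j)) =
        (\<Prod>i<k. w (pick S i)) * kdet k (\<lambda>i j. \<phi> (p i) (pick S j))"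
      using kdet_scale[of k "\<lambda>_. 1" "\<lambda>j. w (pick S j)"] by simp
    moreover have "(\<Prod>i<k. w (pick S i)) > 0"
      using S assms(3) unfolding selects_def by (intro prod_pos) simp
    ultimately show "kdet k (\<lambda>i j. w (pick S j) * \<phi> (p i) (pick S j)) *
        kdet k (\<lambda>i j. \<phi> (q i) (pick S j)) > 0"
      using TP_D[OF assms(1) p S] TP_D[OF assms(1) q S] by simp
  qed
  finally show "kdet k (\<lambda>i j. \<Sum>l<n. w l * \<phi> (p i) l * \<phi> (q j) l) > 0" .
qed

section \<open>Bordering totally positive arrays\<close>

lemma TP_subset: "TP a m n \<Longrightarrow> m' \<le> m \<Longrightarrow> n' \<le> n \<Longrightarrow> TP a m' n'"
  by (rule TP_I) (erule TP_D; erule (1) selects_mono)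

lemma TP_transpose: "TP a m n \<Longrightarrow> TP (\<lambda>i j. a j i) n m"
proof (rule TP_I)
  fix k p q assume "TP a m n" "selects k n p" "selects k m q"
  then show "kdet k (\<lambda>i j. a (q j) (p i)) > 0"
    using kdet_transpose[of k "\<lambda>i j. a (q i) (p j)"] by (simp add: TP_D)
qed

lemma selects_Suc_cases:
  assumes "selects (Suc l) (Suc m) p"
  obtains "selects (Suc l) m p" | "p l = m" "selects l m p"
proof (cases "p l = m")
  case True
  then have "selects l m p" using assms unfolding selects_def by (metis lessI less_SucI)
  with True show ?thesis by (rule that(2))
next
  case False
  have "p i \<le> p l" if "i < Suc l" for i
    using assms that unfolding selects_def by (cases "i = l") (auto simp: less_imp_le)
  moreover have "p l < Suc m" using assms unfolding selects_def by blast
  then have "p l < m" using False by simp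
  ultimately have "p i < m" if "i < Suc l" for i using that by (meson le_less_trans)
  then have "selects (Suc l) m p" using assms unfolding selects_def by blast
  then show ?thesis by (rule that(1))
qed

text \<open>Every minor containing the corner entry \<open>x\<close> is affine in \<open>x\<close> with a smaller minor as slope.\<close>

lemma TP_large_corner:
  assumes a1: "TP a m (Suc n)" and a2: "TP a (Suc m) n"
  shows "\<forall>\<^sub>F x in at_top. TP (\<lambda>i j. if i = m \<and> j = n then x else a i j) (Suc m) (Suc n)"
proof -
  define b where "b x i j = (if i = m \<and> j = n then x else a i j)" for x i j
  have *: "\<forall>\<^sub>F x in at_top. kdet k (\<lambda>i j. b x (p i) (q j)) > 0"
    if p: "selects k (Suc m) p" and q: "selects k (Suc n) q" for k p q
  proof (cases k)
    case 0
    then show ?thesis by simp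
  next
    case (Suc l)
    show ?thesis
    proof (rule selects_Suc_cases[OF p[unfolded Suc]])
      assume p': "selects (Suc l) m p"
      have "kdet k (\<lambda>i j. b x (p i) (q j)) = kdet k (\<lambda>i j. a (p i) (q j))" for x
        using p' Suc unfolding b_def selects_def by (intro kdet_cong) auto
      then show ?thesis using TP_D[OF a1 p'] q Suc by simp
    next
      assume pl: "p l = m" and p': "selects l m p"
      show ?thesis
      proof (rule selects_Suc_cases[OF q[unfolded Suc]])
        assume q': "selects (Suc l) n q"
        have "kdet k (\<lambda>i j. b x (p i) (q j)) = kdet k (\<lambda>i j. a (p i) (q j))" for x
          using q' Suc unfolding b_def selects_def by (intro kdet_cong) auto
        then show ?thesis using TP_D[OF a2 _ q'] p Suc by simp
      next
        assume ql: "q l = n" and q': "selects l n q"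
        define \<mu> where "\<mu> = kdet l (\<lambda>i j. a (p i) (q j))"
        define \<nu> where "\<nu> = kdet (Suc l) (\<lambda>i j. if i = l \<and> j = l then 0 else a (p i) (q j))"
        have \<mu>: "\<mu> > 0" unfolding \<mu>_def
          by (rule TP_D[OF a2 selects_mono[OF p'] q']) simp
        have pm: "p i \<noteq> m" if "i < Suc l" "i \<noteq> l" for i
        proof -
          have "i < l" using that by simp
          then show ?thesis using p' unfolding selects_def by blast
        qed
        have qn: "q i \<noteq> n" if "i < Suc l" "i \<noteq> l" for i
        proof -
          have "i < l" using that by simp
          then show ?thesis using q' unfolding selects_def by blast
        qed
        have "kdet k (\<lambda>i j. b x (p i) (q j)) = x * \<mu> + \<nu>" for x
        proof -
          have "kdet l (\<lambda>i j. b x (p i) (q j)) = \<mu>"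
            unfolding \<mu>_def using pm by (intro kdet_cong) (auto simp: b_def)
          moreover have "kdet (Suc l) (\<lambda>i j. if i = l \<and> j = l then 0 else b x (p i) (q j)) = \<nu>"
            unfolding \<nu>_def using pm qn by (intro kdet_cong) (auto simp: b_def)
          ultimately show ?thesis
            unfolding Suc by (subst kdet_Suc_corner) (simp add: b_def pl ql)
        qed
        moreover have "\<forall>\<^sub>F x in at_top. x * \<mu> + \<nu> > 0"
          using eventually_gt_at_top[of "- \<nu> / \<mu>"]
          by eventually_elim (use \<mu> in \<open>simp add: field_simps\<close>)
        ultimately show ?thesis by simp
      qed
    qed
  qed
  \<comment> \<open>Finitely many minors that are eventually positive are eventually positive
    together. To get finiteness, selections are cut to extensional functions, because
    \<open>selects\<close> leaves the values beyond \<open>k\<close> free.\<close>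
  define A where "A = (SIGMA k:{..Suc m}. ({..<k} \<rightarrow>\<^sub>E {..<Suc m}) \<times> ({..<k} \<rightarrow>\<^sub>E {..<Suc n}))"
  define B where "B = {(k, p, q). (k, p, q) \<in> A \<and> selects k (Suc m) p \<and> selects k (Suc n) q}"
  have "finite A" unfolding A_def by (intro finite_SigmaI finite_cartesian_product finite_PiE) simp_all
  then have "finite B" by (rule rev_finite_subset) (auto simp: B_def)
  then have "\<forall>\<^sub>F x in at_top. \<forall>(k, p, q)\<in>B. kdet k (\<lambda>i j. b x (p i) (q j)) > 0"
    by (rule eventually_ball_finite) (auto simp: B_def intro: *)
  then show ?thesis
    unfolding b_def[symmetric]
  proof eventually_elim
    case (elim x)
    show ?case
    proof (rule TP_I)
      fix k p q assume p: "selects k (Suc m) p" and q: "selects k (Suc n) q"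
      let ?p = "restrict p {..<k}" and ?q = "restrict q {..<k}"
      have "selects k (Suc m) ?p" "selects k (Suc n) ?q"
        using p q unfolding selects_def by auto
      moreover have "k \<le> Suc m" by (rule selects_le[OF p])
      moreover have "?p \<in> {..<k} \<rightarrow>\<^sub>E {..<Suc m}" "?q \<in> {..<k} \<rightarrow>\<^sub>E {..<Suc n}"
        using p q unfolding selects_def by auto
      ultimately have "(k, ?p, ?q) \<in> B" unfolding B_def A_def by blast
      then have "kdet k (\<lambda>i j. b x (?p i) (?q j)) > 0" using elim by blast
      also have "kdet k (\<lambda>i j. b x (?p i) (?q j)) = kdet k (\<lambda>i j. b x (p i) (q j))"
        by (rule kdet_cong) simp
      finally show "kdet k (\<lambda>i j. b x (p i) (q j)) > 0" .
    qed
  qed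
qed

text \<open>The new column is filled from the top down: at the moment an entry is chosen, it is the
  bottom right corner of the rows treated so far, so any sufficiently large value works.\<close>

lemma TP_extend_column:
  assumes "TP a m n"
  shows "\<exists>c. TP (\<lambda>i j. if j = n then c i else a i j) m (Suc n)"
proof -
  have "\<exists>c. TP (\<lambda>i j. if j = n then c i else a i j) r (Suc n)" if "r \<le> m" for r
    using that
  proof (induction r)
    case 0
    show ?case by (auto intro!: TP_I simp: selects_def)
  next
    case (Suc r)
    then obtain c where c: "TP (\<lambda>i j. if j = n then c i else a i j) r (Suc n)" by auto
    have "TP a (Suc r) n" by (rule TP_subset[OF assms]) (use Suc in auto)
    then have "TP (\<lambda>i j. if j = n then c i else a i j) (Suc r) n" by (rule TP_cong_imp) simp
    from eventually_happens[OF TP_large_corner[OF c this]]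
    obtain x where x: "TP (\<lambda>i j. if i = r \<and> j = n then x else if j = n then c i else a i j) (Suc r) (Suc n)"
      by auto
    have "TP (\<lambda>i j. if j = n then (c(r := x)) i else a i j) (Suc r) (Suc n)"
      by (rule TP_cong_imp[OF x]) simp
    then show ?case by blast
  qed
  then show ?thesis by blast
qed

lemma TP_extend_columns:
  assumes "TP a m n" "n \<le> N"
  shows "\<exists>b. (\<forall>i j. j < n \<longrightarrow> b i j = a i j) \<and> TP b m N"
  using assms(2)
proof (induction N rule: dec_induct)
  case base
  show ?case using assms(1) by blast
next
  case (step N)
  then obtain b where b: "\<forall>i j. j < n \<longrightarrow> b i j = a i j" "TP b m N" by blast
  obtain c where c: "TP (\<lambda>i j. if j = N then c i else b i j) m (Suc N)"
    using TP_extend_column[OF b(2)] by blast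
  have "\<forall>i j. j < n \<longrightarrow> (if j = N then c i else b i j) = a i j" using b(1) step by simp
  then show ?case using c by (intro exI[of _ "\<lambda>i j. if j = N then c i else b i j"] conjI)
qed

text \<open>A new column is mirrored into a new row. Both bordered rectangles are totally positive,
  the second as a transpose, and the shared corner is then taken large.\<close>

lemma TP_extend_symmetric:
  assumes sym: "\<And>i j. a i j = a j i" and tp: "TP a d d"
  shows "\<exists>b. (\<forall>i j. b i j = b j i) \<and> (\<forall>i<d. \<forall>j<d. b i j = a i j) \<and> TP b (Suc d) (Suc d)"
proof -
  obtain c where c: "TP (\<lambda>i j. if j = d then c i else a i j) d (Suc d)"
    using TP_extend_column[OF tp] by blast
  define b where "b i j = (if j = d then c i else if i = d then c j else a i j)" for i j
  have 1: "TP b d (Suc d)" by (rule TP_cong_imp[OF c]) (simp add: b_def)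
  have 2: "TP b (Suc d) d" by (rule TP_cong_imp[OF TP_transpose[OF c]]) (simp add: b_def sym)
  obtain x where x: "TP (\<lambda>i j. if i = d \<and> j = d then x else b i j) (Suc d) (Suc d)"
    using eventually_happens[OF TP_large_corner[OF 1 2]] by auto
  show ?thesis
    by (rule exI, intro conjI allI impI, rule_tac[3] x) (auto simp: b_def sym)
qed

lemma preserves_TP_symmetric_Suc:
  assumes "preserves_TP_symmetric (Suc d) F"
  shows "preserves_TP_symmetric d F"
  unfolding preserves_TP_symmetric_iff
proof (intro allI impI)
  fix a :: "nat \<Rightarrow> nat \<Rightarrow> real" assume a: "\<forall>i j. a i j = a j i" "TP a d d"
  from TP_extend_symmetric[OF a(1)[rule_format] a(2)]
  obtain b where b: "\<forall>i j. b i j = b j i" "\<forall>i<d. \<forall>j<d. b i j = a i j" "TP b (Suc d) (Suc d)" by blast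
  then have "TP (\<lambda>i j. F (b i j)) (Suc d) (Suc d)"
    using assms unfolding preserves_TP_symmetric_iff by blast
  then have "TP (\<lambda>i j. F (b i j)) d d" by (rule TP_subset) simp_all
  then show "TP (\<lambda>i j. F (a i j)) d d" by (rule TP_cong_imp) (simp add: b(2))
qed

lemma preserves_TP_symmetric_le:
  assumes "preserves_TP_symmetric n F" "d \<le> n"
  shows "preserves_TP_symmetric d F"
  using assms(2,1) by (induction rule: dec_induct) (auto dest: preserves_TP_symmetric_Suc)

section \<open>Powers preserving positive minors\<close>

lemma TP_select:
  assumes "TP a m n" "selects k m p" "selects l n q"
  shows "TP (\<lambda>i j. a (p i) (q j)) k l"
proof (rule TP_I)
  fix h p' q' assume p': "selects h k p'" and q': "selects h l q'"
  have "selects h m (\<lambda>i. p (p' i))" "selects h n (\<lambda>i. q (q' i))"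
    using assms(2,3) p' q' unfolding selects_def by (meson less_trans)+
  then show "kdet h (\<lambda>i j. a (p (p' i)) (q (q' j))) > 0" by (rule TP_D[OF assms(1)])
qed

lemma TP_pos: "TP a m n \<Longrightarrow> i < m \<Longrightarrow> j < n \<Longrightarrow> a i j > 0"
  using TP_D[of a m n "Suc 0" "\<lambda>_. i" "\<lambda>_. j"] by (simp add: selects_def)

lemma TP_minor_2:
  assumes "TP a m n" "i < k" "k < m" "j < l" "l < n"
  shows "a i l * a k j < a i j * a k l"
proof -
  have "selects 2 m (\<lambda>x. if x = 0 then i else k)" "selects 2 n (\<lambda>x. if x = 0 then j else l)"
    using assms by (auto simp: selects_def less_2_cases_iff)
  from TP_D[OF assms(1) this] show ?thesis by (simp add: kdet_2)
qed

lemma TP_scale: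
  assumes "TP a m n" "\<And>i. i < m \<Longrightarrow> r i > 0" "\<And>j. j < n \<Longrightarrow> s j > 0"
  shows "TP (\<lambda>i j. r i * s j * a i j) m n"
proof (rule TP_I)
  fix k p q assume p: "selects k m p" and q: "selects k n q"
  have "(\<Prod>i<k. r (p i)) > 0" "(\<Prod>i<k. s (q i)) > 0"
    using p q assms(2,3) unfolding selects_def by (auto intro!: prod_pos)
  then show "kdet k (\<lambda>i j. r (p i) * s (q j) * a (p i) (q j)) > 0"
    using TP_D[OF assms(1) p q] by (simp add: kdet_scale[of k "\<lambda>i. r (p i)" "\<lambda>i. s (q i)"])
qed

section \<open>Entrywise powers of 3-by-3 arrays\<close>

lemma powr_chord_ineq:
  fixes p \<beta> y :: real
  assumes "p \<ge> 1" "\<beta> \<ge> 0" "y \<ge> 0"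
  shows "1 - (1 + p * y) powr (- \<beta>) \<le> p * (1 - (1 + y) powr (- \<beta>))"
proof -
  \<comment> \<open>Right side minus left side: it vanishes at 0, and its derivative is nonnegative
    because \<open>1 + p * x \<ge> 1 + x\<close> while the exponent \<open>- \<beta> - 1\<close> is
    negative.\<close>
  define \<phi> where "\<phi> y = p * (1 - (1 + y) powr (- \<beta>)) - (1 - (1 + p * y) powr (- \<beta>))" for y
  have "\<phi> 0 \<le> \<phi> y"
  proof (rule DERIV_nonneg_imp_nondecreasing[OF assms(3)])
    fix x :: real assume x: "0 \<le> x"
    have "0 \<le> p * x" using x assms by simp
    then have "(\<phi> has_real_derivative
        p * \<beta> * (1 + x) powr (- \<beta> - 1) - p * \<beta> * (1 + p * x) powr (- \<beta> - 1)) (at x)"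
      unfolding \<phi>_def using x by (auto intro!: derivative_eq_intros simp: algebra_simps)
    moreover have "(1 + p * x) powr (- \<beta> - 1) \<le> (1 + x) powr (- \<beta> - 1)"
      using assms x mult_right_mono[of 1 p x] by (intro powr_mono2') auto
    then have "p * \<beta> * (1 + p * x) powr (- \<beta> - 1) \<le> p * \<beta> * (1 + x) powr (- \<beta> - 1)"
      using assms by (intro mult_left_mono) auto
    ultimately show "\<exists>z. (\<phi> has_real_derivative z) (at x) \<and> 0 \<le> z" by force
  qed
  then show ?thesis by (simp add: \<phi>_def)
qed

text \<open>Logarithmic convexity of \<open>s \<mapsto> (1 + exp s) powr \<alpha> - 1\<close>, written multiplicatively.\<close>

lemma powr_minus_one_log_convex:
  fixes \<alpha> x p q :: real
  assumes "\<alpha> \<ge> 1" "x > 0" "p \<ge> 1" "q \<ge> 1"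
  shows "((1 + p * x) powr \<alpha> - 1) * ((1 + q * x) powr \<alpha> - 1)
       \<le> ((1 + x) powr \<alpha> - 1) * ((1 + p * q * x) powr \<alpha> - 1)"
proof -
  define G where "G y = (1 + y) powr \<alpha> - 1" for y :: real
  have G_pos: "G y > 0" if "y > 0" for y
    using that assms(1) powr_less_mono2[of \<alpha> 1 "1 + y"] by (simp add: G_def)
  have dG: "(G has_real_derivative \<alpha> * (1 + y) powr (\<alpha> - 1)) (at y)" if "y > 0" for y
    unfolding G_def using that by (auto intro!: derivative_eq_intros)
  \<comment> \<open>The increment of \<open>ln G\<close> over a step of length \<open>ln p\<close>
    in the variable \<open>ln y\<close>. Log-convexity says that it grows with \<open>y\<close>; the
    claim compares it at \<open>x\<close> and at \<open>q * x\<close>.\<close>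
  define r where "r y = ln (G (p * y)) - ln (G y)" for y
  have "r x \<le> r (q * x)"
  proof (rule DERIV_nonneg_imp_nondecreasing[of x "q * x" r])
    show "x \<le> q * x" using assms by simp
    fix y assume "x \<le> y"
    then have y: "y > 0" "p * y > 0" using assms by auto
    have dGp: "((\<lambda>y. G (p * y)) has_real_derivative \<alpha> * (1 + p * y) powr (\<alpha> - 1) * p) (at y)"
      by (rule DERIV_chain2[where f = G and g = "\<lambda>y. p * y", OF dG[OF y(2)]])
        (auto intro!: derivative_eq_intros)
    have "(r has_real_derivative
        \<alpha> * (1 + p * y) powr (\<alpha> - 1) * p / G (p * y) - \<alpha> * (1 + y) powr (\<alpha> - 1) / G y) (at y)"
      using DERIV_diff[OF
          DERIV_chain2[where f = ln and g = "\<lambda>y. G (p * y)", OF DERIV_ln_divide[OF G_pos[OF y(2)]] dGp]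
          DERIV_chain2[where f = ln and g = G, OF DERIV_ln_divide[OF G_pos[OF y(1)]] dG[OF y(1)]]]
      unfolding r_def by simp
    moreover have "(1 + y) powr (\<alpha> - 1) * G (p * y) \<le> (1 + p * y) powr (\<alpha> - 1) * p * G y"
    proof -
      \<comment> \<open>In these terms both sides contain \<open>p * y * u * v\<close>. After
        cancelling it, the claim is \<open>powr_chord_ineq\<close> for the exponent
        \<open>\<alpha> - 1\<close>, multiplied by \<open>u * v\<close>.\<close>
      define u v where "u = (1 + y) powr (\<alpha> - 1)" and "v = (1 + p * y) powr (\<alpha> - 1)"
      have uv: "u > 0" "v > 0" using y by (simp_all add: u_def v_def)
      have G1: "G y = u * (1 + y) - 1" "G (p * y) = v * (1 + p * y) - 1"
        using y by (simp_all add: G_def u_def v_def powr_diff)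
      have "1 - inverse v \<le> p * (1 - inverse u)"
        using powr_chord_ineq[of p "\<alpha> - 1" y] assms y
        by (simp add: u_def v_def powr_minus[symmetric])
      then have "(1 - inverse v) * (u * v) \<le> p * (1 - inverse u) * (u * v)"
        using uv by (intro mult_right_mono) auto
      moreover have "(1 - inverse v) * (u * v) = u * v - u" "p * (1 - inverse u) * (u * v) = p * (u * v - v)"
        using uv by (simp_all add: left_diff_distrib)
      ultimately have "u * v - u \<le> p * (u * v - v)" by simp
      then show ?thesis
        unfolding G1 u_def[symmetric] v_def[symmetric] by (simp add: algebra_simps)
    qed
    then have "\<alpha> * (1 + y) powr (\<alpha> - 1) / G y \<le> \<alpha> * (1 + p * y) powr (\<alpha> - 1) * p / G (p * y)"
      using assms(1) G_pos[OF y(1)] G_pos[OF y(2)] by (simp add: field_simps)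
    ultimately show "\<exists>z. (r has_real_derivative z) (at y) \<and> 0 \<le> z" by force
  qed
  moreover have pos: "G x > 0" "G (p * x) > 0" "G (q * x) > 0" "G (p * q * x) > 0"
    using assms by (auto intro!: G_pos)
  ultimately have "ln (G (p * x) * G (q * x)) \<le> ln (G x * G (p * q * x))"
    by (simp add: r_def ln_mult mult.assoc)
  then have "G (p * x) * G (q * x) \<le> G x * G (p * q * x)" using pos by simp
  then show ?thesis by (simp add: G_def)
qed

lemma kdet_3_powr_pos:
  assumes "TP a 3 3" "\<alpha> \<ge> 1"
  shows "kdet 3 (\<lambda>i j. a i j powr \<alpha>) > 0"
proof -
  have pos: "a i j > 0" if "i < 3" "j < 3" for i j using TP_pos[OF assms(1)] that by blast
  define r s where "r i = inverse (a i 0)" and "s j = a 0 0 / a 0 j" for i j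
  define b where "b i j = r i * s j * a i j" for i j
  have rs: "r i > 0" "s i > 0" if "i < 3" for i using pos that by (simp_all add: r_def s_def)
  have b: "TP b 3 3" unfolding b_def by (rule TP_scale[OF assms(1)]) (use rs in auto)
  have b1: "b 0 j = 1" "b j 0 = 1" if "j < 3" for j
    using pos[of 0 j] pos[of j 0] pos[of 0 0] that by (simp_all add: b_def r_def s_def)
  define A B C D where "A = b 1 1 - 1" and "B = b 1 2 - 1" and "C = b 2 1 - 1" and "D = b 2 2 - 1"
  have "A > 0" using TP_minor_2[OF b, of 0 1 0 1] by (simp add: b1 A_def)
  have "A < B" using TP_minor_2[OF b, of 0 1 1 2] by (simp add: b1 A_def B_def)
  have "A < C" using TP_minor_2[OF b, of 1 2 0 1] by (simp add: b1 A_def C_def)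
  have "kdet 3 b > 0" using TP_D[OF b selects_id selects_id, of 3] by simp
  then have "B * C < A * D"
    by (simp add: kdet_3 b1 A_def B_def C_def D_def algebra_simps)
  \<comment> \<open>With ones in the first row and column the determinant is
    \<open>A * D - B * C\<close>, and the same holds for the powers with
    \<open>(1 + A) powr \<alpha> - 1\<close> in place of \<open>A\<close>, and so on. Log-convexity
    handles the borderline last entry \<open>p * q * A = B * C / A\<close>; monotonicity then passes
    to the larger \<open>D\<close>.\<close>
  define p q where "p = B / A" and "q = C / A"
  have pq: "p \<ge> 1" "q \<ge> 1" "p * A = B" "q * A = C" "p * q * A < D"
    using \<open>A > 0\<close> \<open>A < B\<close> \<open>A < C\<close> \<open>B * C < A * D\<close> by (simp_all add: p_def q_def field_simps)
  have "0 < p * q * A" using pq(1,2) \<open>A > 0\<close> by (simp add: zero_less_mult_iff)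
  have "((1 + B) powr \<alpha> - 1) * ((1 + C) powr \<alpha> - 1) \<le> ((1 + A) powr \<alpha> - 1) * ((1 + p * q * A) powr \<alpha> - 1)"
    using powr_minus_one_log_convex[OF assms(2) \<open>A > 0\<close> pq(1,2)] pq(3,4) by simp
  also have "\<dots> < ((1 + A) powr \<alpha> - 1) * ((1 + D) powr \<alpha> - 1)"
    using assms(2) \<open>A > 0\<close> pq(5) \<open>0 < p * q * A\<close> powr_less_mono2[of \<alpha> 1 "1 + A"]
    by (intro mult_strict_left_mono diff_strict_right_mono powr_less_mono2) auto
  finally have "kdet 3 (\<lambda>i j. b i j powr \<alpha>) > 0"
    by (simp add: kdet_3 b1 A_def B_def C_def D_def algebra_simps)
  also have "kdet 3 (\<lambda>i j. b i j powr \<alpha>) = kdet 3 (\<lambda>i j. r i powr \<alpha> * s j powr \<alpha> * a i j powr \<alpha>)"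
    using pos rs by (intro kdet_cong) (simp add: b_def powr_mult less_imp_le)
  also have "\<dots> = (\<Prod>i<3. r i powr \<alpha>) * (\<Prod>i<3. s i powr \<alpha>) * kdet 3 (\<lambda>i j. a i j powr \<alpha>)"
    by (rule kdet_scale)
  finally have "0 < (\<Prod>i<3. r i powr \<alpha>) * (\<Prod>i<3. s i powr \<alpha>) * kdet 3 (\<lambda>i j. a i j powr \<alpha>)" .
  moreover have "(\<Prod>i<3. r i powr \<alpha>) * (\<Prod>i<3. s i powr \<alpha>) \<ge> 0"
    by (intro mult_nonneg_nonneg prod_nonneg) auto
  ultimately show ?thesis by (metis zero_less_mult_pos mult_eq_0_iff order_less_le)
qed

lemma kdet_2_powr_pos:
  assumes "TP a 2 2" "\<alpha> > 0"
  shows "kdet 2 (\<lambda>i j. a i j powr \<alpha>) > 0"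
proof -
  have pos: "a i j > 0" if "i < 2" "j < 2" for i j using TP_pos[OF assms(1)] that by blast
  have "a 0 1 * a 1 0 < a 0 0 * a 1 1" by (rule TP_minor_2[OF assms(1)]) auto
  then have "(a 0 1 * a 1 0) powr \<alpha> < (a 0 0 * a 1 1) powr \<alpha>"
    using pos assms(2) by (intro powr_less_mono2) (auto intro!: mult_nonneg_nonneg less_imp_le)
  then show ?thesis using pos by (simp add: kdet_2 powr_mult less_imp_le)
qed

lemma kdet_powr_pos:
  assumes "TP a m n" "\<alpha> \<ge> 1" "selects k m p" "selects k n q" "k \<le> 3"
  shows "kdet k (\<lambda>i j. a (p i) (q j) powr \<alpha>) > 0"
proof -
  have T: "TP (\<lambda>i j. a (p i) (q j)) k k" by (rule TP_select[OF assms(1,3,4)])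
  have "k = 0 \<or> k = Suc 0 \<or> k = 2 \<or> k = 3" using assms(5) by auto
  then show ?thesis
  proof (elim disjE)
    assume "k = 2" then show ?thesis using kdet_2_powr_pos[of "\<lambda>i j. a (p i) (q j)"] T assms(2) by simp
  next
    assume "k = 3" then show ?thesis using kdet_3_powr_pos[of "\<lambda>i j. a (p i) (q j)"] T assms(2) by simp
  next
    assume "k = Suc 0" then show ?thesis using TP_pos[OF T, of 0 0] by simp
  qed simp
qed

section \<open>Quadratic forms, Schur products and determinants\<close>

definition qform :: "'a set \<Rightarrow> ('a \<Rightarrow> 'a \<Rightarrow> real) \<Rightarrow> ('a \<Rightarrow> real) \<Rightarrow> real" where
  "qform S c v = (\<Sum>i\<in>S. \<Sum>j\<in>S. v i * v j * c i j)"

text \<open>The index set is arbitrary so that inductions can split off one index; \<open>v\<close>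
  must be nonzero somewhere on \<open>S\<close> because its other values do not enter the
  form.\<close>

definition pos_def :: "'a set \<Rightarrow> ('a \<Rightarrow> 'a \<Rightarrow> real) \<Rightarrow> bool" where
  "pos_def S c \<longleftrightarrow> (\<forall>v. (\<exists>i\<in>S. v i \<noteq> 0) \<longrightarrow> qform S c v > 0)"

lemma pos_defD: "pos_def S c \<Longrightarrow> i \<in> S \<Longrightarrow> v i \<noteq> 0 \<Longrightarrow> qform S c v > 0"
  unfolding pos_def_def by blast

lemma qform_zero: "(\<And>i. i \<in> S \<Longrightarrow> v i = 0) \<Longrightarrow> qform S c v = 0"
  unfolding qform_def by simp

lemma pos_def_nonneg: "pos_def S c \<Longrightarrow> qform S c v \<ge> 0"
  using qform_zero[of S v c] pos_defD[of S c _ v] by (metis less_eq_real_def)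

lemma qform_cong:
  "(\<And>i j. i \<in> S \<Longrightarrow> j \<in> S \<Longrightarrow> v i * v j * c i j = w i * w j * d i j) \<Longrightarrow> qform S c v = qform S d w"
  unfolding qform_def by (intro sum.cong refl)

lemma qform_insert:
  assumes "finite S" "x \<notin> S" "\<And>i j. c i j = c j i"
  shows "qform (insert x S) c v = (v x)\<^sup>2 * c x x + 2 * v x * (\<Sum>i\<in>S. v i * c i x) + qform S c v"
proof -
  have "qform (insert x S) c v = v x * v x * c x x + (\<Sum>j\<in>S. v x * v j * c x j)
      + (\<Sum>i\<in>S. v i * v x * c i x + (\<Sum>j\<in>S. v i * v j * c i j))"
    unfolding qform_def using assms(1,2) by simp
  also have "(\<Sum>j\<in>S. v x * v j * c x j) = v x * (\<Sum>i\<in>S. v i * c i x)"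
    unfolding sum_distrib_left by (intro sum.cong refl) (simp add: assms(3)[of x])
  also have "(\<Sum>i\<in>S. v i * v x * c i x + (\<Sum>j\<in>S. v i * v j * c i j)) =
      v x * (\<Sum>i\<in>S. v i * c i x) + qform S c v"
    unfolding sum.distrib qform_def sum_distrib_left
    by (intro arg_cong2[where f = "(+)"] sum.cong refl) simp
  finally show ?thesis by (simp add: power2_eq_square algebra_simps)
qed

lemma qform_add: "qform S (\<lambda>i j. c i j + d i j) v = qform S c v + qform S d v"
  unfolding qform_def by (simp add: sum.distrib algebra_simps)

lemma qform_smult: "qform S (\<lambda>i j. k * c i j) v = k * qform S c v"
  unfolding qform_def by (simp add: sum_distrib_left mult_ac)

lemma qform_rank_one: "qform S (\<lambda>i j. u i * u j) v = (\<Sum>i\<in>S. v i * u i)\<^sup>2"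
  unfolding qform_def power2_eq_square sum_product by (simp add: mult_ac)

lemma pos_def_diag: "finite S \<Longrightarrow> pos_def S c \<Longrightarrow> x \<in> S \<Longrightarrow> c x x > 0"
proof -
  assume S: "finite S" "x \<in> S" and c: "pos_def S c"
  have "qform S c (\<lambda>i. if i = x then 1 else 0) = c x x"
  proof -
    have "(\<Sum>j\<in>S. (if i = x then 1 else 0) * (if j = x then 1 else 0) * c i j) =
        (if i = x then c x x else 0)" for i
      using S by (cases "i = x") (simp_all add: if_distrib[where f = "\<lambda>t. t * _"] cong: if_cong)
    then show ?thesis unfolding qform_def using S by simp
  qed
  then show ?thesis using pos_defD[OF c S(2), of "\<lambda>i. if i = x then 1 else 0"] by simp
qed

lemma pos_def_schur_complement:
  assumes S: "finite S" "x \<notin> S" and sym: "\<And>i j. c i j = c j i" and c: "pos_def (insert x S) c"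
  shows "pos_def S (\<lambda>i j. c i j - c i x * c j x / c x x)"
  unfolding pos_def_def
proof (intro allI impI)
  fix v :: "'a \<Rightarrow> real" assume "\<exists>i\<in>S. v i \<noteq> 0"
  then obtain i where i: "i \<in> S" "v i \<noteq> 0" by blast
  have cx: "c x x > 0" by (rule pos_def_diag[OF _ c]) (use S in auto)
  define t where "t = (\<Sum>i\<in>S. v i * c i x)"
  \<comment> \<open>With \<open>v\<close> fixed on \<open>S\<close>, this value at \<open>x\<close>
    minimizes the enlarged form; completing the square leaves exactly the form of the Schur
    complement.\<close>
  define w where "w = v(x := - t / c x x)"
  have wS: "w j = v j" if "j \<in> S" for j using that S(2) by (auto simp: w_def)
  have "qform (insert x S) c w > 0" by (rule pos_defD[OF c, of i]) (use i wS in auto)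
  also have "qform (insert x S) c w = (w x)\<^sup>2 * c x x + 2 * w x * t + qform S c v"
  proof -
    have "(\<Sum>i\<in>S. w i * c i x) = t" "qform S c w = qform S c v"
      unfolding t_def using wS by (auto intro!: sum.cong qform_cong)
    then show ?thesis unfolding qform_insert[of S x c, OF S sym] by simp
  qed
  also have "\<dots> = qform S c v - t\<^sup>2 / c x x"
    using cx by (simp add: w_def power2_eq_square field_simps)
  also have "\<dots> = qform S c v + (- 1 / c x x) * qform S (\<lambda>i j. c i x * c j x) v"
    unfolding qform_rank_one t_def by simp
  also have "\<dots> = qform S (\<lambda>i j. c i j - c i x * c j x / c x x) v"
    unfolding qform_smult[symmetric] qform_add[symmetric] by (rule qform_cong) simp
  finally show "qform S (\<lambda>i j. c i j - c i x * c j x / c x x) v > 0" .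
qed

text \<open>Split \<open>c\<close> into the rank-one part \<open>c i x * c j x / c x x\<close> and
  the Schur complement of \<open>x\<close>. The rank-one part times \<open>h\<close> is the form of
  \<open>h\<close> at a rescaled vector. The complement vanishes in row and column \<open>x\<close>,
  so induction on \<open>S\<close> applies to it. Vectors supported at \<open>x\<close> alone are
  settled by \<open>h x x > 0\<close>.\<close>

lemma pos_def_schur_product:
  assumes "finite S" "\<And>i j. c i j = c j i" "pos_def S c"
    and "\<And>v. qform S h v \<ge> 0" "\<And>i. i \<in> S \<Longrightarrow> h i i > 0" "\<And>i j. h i j = h j i"
  shows "pos_def S (\<lambda>i j. c i j * h i j)"
  using assms
proof (induction S arbitrary: c rule: finite_induct)
  case empty
  then show ?case by (simp add: pos_def_def)
next
  case (insert x S)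
  let ?d = "\<lambda>i j. c i j - c i x * c j x / c x x"
  have cx: "c x x > 0" by (rule pos_def_diag[OF _ insert.prems(2)]) (use insert in auto)
  have "qform S h v \<ge> 0" for v
  proof -
    define w where "w = v(x := 0)"
    have "(\<Sum>i\<in>S. w i * h i x) = (\<Sum>i\<in>S. v i * h i x)" "qform S h w = qform S h v"
      unfolding w_def using insert.hyps by (auto intro!: sum.cong qform_cong)
    then have "qform (insert x S) h w = qform S h v"
      unfolding qform_insert[of S x h, OF insert.hyps insert.prems(5)] by (simp add: w_def)
    then show ?thesis using insert.prems(3)[of w] by simp
  qed
  then have IH: "pos_def S (\<lambda>i j. ?d i j * h i j)"
    using insert.prems
    by (intro insert.IH pos_def_schur_complement insert.hyps) (auto simp: mult.commute)
  show ?case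
    unfolding pos_def_def
  proof (intro allI impI)
    fix v :: "'a \<Rightarrow> real" assume v: "\<exists>i\<in>insert x S. v i \<noteq> 0"
    have "qform (insert x S) (\<lambda>i j. c i j * h i j) v =
        qform (insert x S) (\<lambda>i j. 1 / c x x * (c i x * c j x * h i j) + ?d i j * h i j) v"
      by (rule qform_cong) (simp add: algebra_simps)
    also have "\<dots> = 1 / c x x * qform (insert x S) h (\<lambda>i. v i * c i x)
        + qform (insert x S) (\<lambda>i j. ?d i j * h i j) v"
    proof -
      have "qform (insert x S) (\<lambda>i j. c i x * c j x * h i j) v = qform (insert x S) h (\<lambda>i. v i * c i x)"
        by (rule qform_cong) simp
      then show ?thesis unfolding qform_add qform_smult by simp
    qed
    also have "qform (insert x S) (\<lambda>i j. ?d i j * h i j) v = qform S (\<lambda>i j. ?d i j * h i j) v"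
    proof -
      define d where "d = ?d"
      have dx: "d i x = 0" "d x i = 0" for i
        using cx insert.prems(1)[of x i] by (simp_all add: d_def)
      have "qform (insert x S) (\<lambda>i j. d i j * h i j) v = qform S (\<lambda>i j. d i j * h i j) v"
        unfolding qform_def using insert.hyps by (simp add: dx)
      then show ?thesis by (simp only: d_def)
    qed
    finally have eq: "qform (insert x S) (\<lambda>i j. c i j * h i j) v =
        1 / c x x * qform (insert x S) h (\<lambda>i. v i * c i x) + qform S (\<lambda>i j. ?d i j * h i j) v" .
    have nn: "1 / c x x * qform (insert x S) h (\<lambda>i. v i * c i x) \<ge> 0"
      using insert.prems(3) cx by simp
    show "qform (insert x S) (\<lambda>i j. c i j * h i j) v > 0"
    proof (cases "\<exists>i\<in>S. v i \<noteq> 0")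
      case True
      then have "qform S (\<lambda>i j. ?d i j * h i j) v > 0" using IH unfolding pos_def_def by blast
      then show ?thesis unfolding eq using nn by linarith
    next
      case False
      then have vS: "v i = 0" if "i \<in> S" for i using that by blast
      then have "v x \<noteq> 0" using v by auto
      have "qform (insert x S) (\<lambda>i j. c i j * h i j) v = v x * v x * (c x x * h x x)"
        unfolding qform_def using insert.hyps vS by simp
      moreover have "c x x * h x x > 0" using cx insert.prems(4) by simp
      moreover have "v x * v x > 0" using \<open>v x \<noteq> 0\<close> by (metis not_square_less_zero mult_eq_0_iff linorder_cases)
      ultimately show ?thesis by simp
    qed
  qed
qed

text \<open>FitzGerald-Horn: after scaling row and column \<open>x\<close> to ones, move along \<open>1 + \<lambda> e\<close> from the
  all-ones matrix; the derivative is a Schur product with a matrix of smaller size and exponent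
  \<open>\<beta> - 1\<close>.\<close>

lemma qform_powr:
  assumes "finite S" "\<And>i j. h i j = h j i" "\<And>i j. i \<in> S \<Longrightarrow> j \<in> S \<Longrightarrow> h i j > 0"
    "pos_def S h" "\<beta> \<ge> real (card S) - 2"
  shows "qform S (\<lambda>i j. h i j powr \<beta>) v \<ge> 0 \<and>
    (\<beta> > 0 \<longrightarrow> (\<exists>i\<in>S. v i \<noteq> 0) \<longrightarrow> qform S (\<lambda>i j. h i j powr \<beta>) v > 0)"
  using assms
proof (induction S arbitrary: h \<beta> v rule: finite_induct)
  case empty
  then show ?case by (simp add: qform_def)
next
  case (insert x S)
  have hx: "h x x > 0" "h i x > 0" "h x i > 0" if "i \<in> S" for i using insert.prems(2) that by auto
  have hxx: "h x x > 0" using insert.prems(2) by auto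
  \<comment> \<open>Normalized to ones in row and column \<open>x\<close>, the array
    \<open>h\<close> becomes \<open>1 + e\<close>. So \<open>e\<close> vanishes there, and on
    \<open>S\<close> it is the Schur complement of \<open>x\<close> up to a diagonal
    rescaling.\<close>
  define e where "e i j = h i j * h x x / (h i x * h j x) - 1" for i j
  define r where "r i = (h i x / sqrt (h x x)) powr \<beta>" for i
  define w where "w i = v i * r i" for i
  have e_sym: "e i j = e j i" for i j
    by (simp add: e_def insert.prems(1)[of i j] mult.commute)
  have ex: "e i x = 0" "e x i = 0" if "i \<in> insert x S" for i
    using insert.prems(2)[of i x] hxx that by (auto simp: e_def insert.prems(1)[of x i])
  have e1: "1 + e i j > 0" if "i \<in> insert x S" "j \<in> insert x S" for i j
    using insert.prems(2)[OF that] insert.prems(2)[of i x] insert.prems(2)[of j x] hxx that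
    by (simp add: e_def)
  have h_eq: "v i * v j * h i j powr \<beta> = w i * w j * (1 + e i j) powr \<beta>"
    if "i \<in> insert x S" "j \<in> insert x S" for i j
  proof -
    have p: "h i x > 0" "h j x > 0" "h i j > 0" using insert.prems(2) that by auto
    have "h i j = (h i x / sqrt (h x x)) * (h j x / sqrt (h x x)) * (1 + e i j)"
      using p hxx by (simp add: e_def)
    moreover have "(h i x / sqrt (h x x)) * (h j x / sqrt (h x x)) \<ge> 0"
      "h i x / sqrt (h x x) \<ge> 0" "h j x / sqrt (h x x) \<ge> 0" "1 + e i j \<ge> 0"
      using p hxx e1[OF that] by simp_all
    ultimately have "h i j powr \<beta> = r i * r j * (1 + e i j) powr \<beta>"
      unfolding r_def by (metis powr_mult)
    then show ?thesis by (simp add: w_def)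
  qed
  define \<psi> where "\<psi> t = qform (insert x S) (\<lambda>i j. (1 + t * e i j) powr \<beta>) w" for t
  have \<psi>1: "qform (insert x S) (\<lambda>i j. h i j powr \<beta>) v = \<psi> 1"
    unfolding \<psi>_def by (rule qform_cong) (simp add: h_eq)
  have \<psi>0: "\<psi> 0 = (\<Sum>i\<in>insert x S. w i)\<^sup>2"
    using qform_rank_one[of "insert x S" "\<lambda>_. 1" w] by (simp add: \<psi>_def)
  have te: "1 + t * e i j > 0" if "0 \<le> t" "t \<le> 1" "i \<in> insert x S" "j \<in> insert x S" for t i j
  proof -
    have "0 < (1 - t) + t * (1 + e i j)"
    proof (cases "t = 0")
      case False
      then show ?thesis using that e1[OF that(3,4)] by (intro add_nonneg_pos) auto
    qed simp
    then show ?thesis by (simp add: algebra_simps)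
  qed
  define \<psi>' where "\<psi>' t = \<beta> * qform S (\<lambda>i j. e i j * (1 + t * e i j) powr (\<beta> - 1)) w" for t
  have d\<psi>: "(\<psi> has_real_derivative \<psi>' t) (at t)" if t: "0 \<le> t" "t \<le> 1" for t
  proof -
    have "(\<psi> has_real_derivative
        qform (insert x S) (\<lambda>i j. \<beta> * (e i j * (1 + t * e i j) powr (\<beta> - 1))) w) (at t)"
      unfolding \<psi>_def qform_def
    proof (intro DERIV_sum)
      fix i j assume ij: "i \<in> insert x S" "j \<in> insert x S"
      show "((\<lambda>t. w i * w j * (1 + t * e i j) powr \<beta>) has_real_derivative
          w i * w j * (\<beta> * (e i j * (1 + t * e i j) powr (\<beta> - 1)))) (at t)"
        using te[OF t ij] by (auto intro!: derivative_eq_intros)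
    qed
    also have "qform (insert x S) (\<lambda>i j. \<beta> * (e i j * (1 + t * e i j) powr (\<beta> - 1))) w = \<psi>' t"
      unfolding qform_smult \<psi>'_def
      unfolding qform_def using insert.hyps by (simp add: ex)
    finally show ?thesis .
  qed
  have contin: "continuous_on {0..1} \<psi>"
    using d\<psi> by (intro DERIV_continuous_on[of _ _ \<psi>']) (auto intro: has_field_derivative_at_within)
  \<comment> \<open>The mean value theorem reduces the sign of \<open>\<psi> 1 - \<psi> 0\<close> to
    the single matrix \<open>1 + z * e\<close>, which on \<open>S\<close> is again positive definite
    with positive entries, so that the induction hypothesis covers it.\<close>
  have "\<exists>l z. 0 < z \<and> z < 1 \<and> (\<psi> has_real_derivative l) (at z) \<and> \<psi> 1 - \<psi> 0 = (1 - 0) * l"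
  proof (intro MVT contin)
    fix t :: real assume "0 < t" "t < 1"
    then show "\<psi> differentiable (at t)"
      unfolding real_differentiable_def using d\<psi>[of t] by auto
  qed simp
  then obtain z where z: "0 < z" "z < 1" "\<psi> 1 - \<psi> 0 = \<psi>' z"
    using d\<psi> DERIV_unique by (metis less_imp_le mult_1 diff_zero)
  define k where "k i j = 1 + z * e i j" for i j
  have k_pos: "k i j > 0" if "i \<in> S" "j \<in> S" for i j using te[of z i j] z that by (simp add: k_def)
  have k_sym: "k i j = k j i" for i j by (simp add: k_def e_sym)
  have e_pd: "pos_def S e"
    unfolding pos_def_def
  proof (intro allI impI)
    fix u :: "'a \<Rightarrow> real" assume "\<exists>i\<in>S. u i \<noteq> 0"
    then obtain i where i: "i \<in> S" "u i \<noteq> 0" by blast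
    define u' where "u' i = u i * sqrt (h x x) / h i x" for i
    have "0 < qform S (\<lambda>i j. h i j - h i x * h j x / h x x) u'"
      by (rule pos_defD[OF pos_def_schur_complement[OF insert.hyps insert.prems(1,3)], of i])
        (use i hx(2)[OF i(1)] hxx in \<open>simp_all add: u'_def\<close>)
    also have "\<dots> = qform S e u"
    proof (rule qform_cong)
      fix i j assume ij: "i \<in> S" "j \<in> S"
      have "u' i * u' j = u i * u j * h x x / (h i x * h j x)"
        using hxx by (simp add: u'_def)
      then show "u' i * u' j * (h i j - h i x * h j x / h x x) = u i * u j * e i j"
        using hx(2)[OF ij(1)] hx(2)[OF ij(2)] hxx by (simp add: e_def field_simps)
    qed
    finally show "qform S e u > 0" .
  qed
  have k_pd: "pos_def S k"
    unfolding pos_def_def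
  proof (intro allI impI)
    fix u :: "'a \<Rightarrow> real" assume "\<exists>i\<in>S. u i \<noteq> 0"
    then have "qform S e u > 0" using e_pd unfolding pos_def_def by blast
    moreover have "qform S k u = (\<Sum>i\<in>S. u i)\<^sup>2 + z * qform S e u"
      unfolding k_def qform_add qform_smult using qform_rank_one[of S "\<lambda>_. 1" u] by simp
    ultimately show "qform S k u > 0" using z by (simp add: add_nonneg_pos)
  qed
  \<comment> \<open>\<open>\<beta> - 1\<close> need not be positive, so only the weak half of the
    induction hypothesis is available; strictness comes from \<open>e\<close> through the Schur
    product.\<close>
  have k_psd: "qform S (\<lambda>i j. k i j powr (\<beta> - 1)) u \<ge> 0" for u
    using insert.IH[of k "\<beta> - 1" u] k_sym k_pos k_pd insert.prems(4) insert.hyps by simp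
  have pd: "pos_def S (\<lambda>i j. e i j * k i j powr (\<beta> - 1))"
  proof (rule pos_def_schur_product[OF insert.hyps(1) e_sym e_pd k_psd])
    fix i assume "i \<in> S"
    then show "k i i powr (\<beta> - 1) > 0" using k_pos[of i i] by simp
  qed (simp add: k_sym)
  have \<psi>'z: "\<psi>' z = \<beta> * qform S (\<lambda>i j. e i j * k i j powr (\<beta> - 1)) w"
    by (simp add: \<psi>'_def k_def)
  \<comment> \<open>A negative \<open>\<beta>\<close> occurs only for a single index, where the
    derivative is an empty sum; for nonempty \<open>S\<close> the bound gives
    \<open>\<beta> \<ge> card S - 1 \<ge> 0\<close>.\<close>
  have S0: "S = {} \<or> \<beta> \<ge> 0"
  proof (cases "S = {}")
    case False
    then have "card S \<ge> 1" using insert.hyps(1) by (simp add: Suc_le_eq card_gt_0_iff)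
    then show ?thesis using insert.prems(4) insert.hyps by simp
  qed simp
  have "\<psi>' z \<ge> 0"
    using S0 pos_def_nonneg[OF pd, of w] unfolding \<psi>'z by (auto simp: qform_def)
  then have "\<psi> 1 \<ge> 0" using z(3) \<psi>0 zero_le_power2[of "\<Sum>i\<in>insert x S. w i"] by linarith
  moreover have "\<psi> 1 > 0" if "\<beta> > 0" "\<exists>i\<in>insert x S. v i \<noteq> 0"
  proof (cases "\<exists>i\<in>S. v i \<noteq> 0")
    case True
    then obtain i where i: "i \<in> S" "v i \<noteq> 0" by blast
    then have "w i \<noteq> 0" using hx[OF i(1)] by (simp add: w_def r_def)
    then have "\<psi>' z > 0" unfolding \<psi>'z using pos_defD[OF pd i(1)] that(1) by simp
    then show ?thesis using z(3) \<psi>0 zero_le_power2[of "\<Sum>i\<in>insert x S. w i"] by linarith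
  next
    case False
    then have vS: "v i = 0" if "i \<in> S" for i using that by blast
    then have "v x \<noteq> 0" using that(2) by auto
    then have "w x \<noteq> 0" using hxx by (simp add: w_def r_def)
    have wS: "w i = 0" if "i \<in> S" for i using vS[OF that] by (simp add: w_def)
    have "\<psi>' z = 0" unfolding \<psi>'z using qform_zero[of S w] wS by simp
    moreover have "\<psi> 0 = (w x)\<^sup>2" unfolding \<psi>0 using insert.hyps wS by simp
    ultimately show ?thesis using z(3) \<open>w x \<noteq> 0\<close> by simp
  qed
  ultimately show ?case unfolding \<psi>1 by blast
qed

text \<open>Sylvester's criterion. The last column \<open>w\<close> of the adjugate is mapped by
  \<open>a\<close> to a multiple of the last unit vector, so for the form it is orthogonal to every
  \<open>u\<close> with \<open>u n = 0\<close>. Writing \<open>v = u + s * w\<close> therefore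
  splits the form into that of \<open>u\<close>, covered by induction, and a square times the
  product of the last two leading minors.\<close>

lemma pos_def_leading_minors:
  assumes sym: "\<And>i j. a i j = a j i" and pos: "\<And>k. k \<le> n \<Longrightarrow> kdet k a > 0"
  shows "pos_def {..<n} a"
  using pos
proof (induction n)
  case 0
  then show ?case by (simp add: pos_def_def)
next
  case (Suc n)
  have IH: "pos_def {..<n} a" using Suc by simp
  let ?A = "mat (Suc n) (Suc n) (\<lambda>(i, j). a i j)"
  define w where "w j = adj_mat ?A $$ (j, n)" for j
  define D where "D = kdet (Suc n) a"
  have D: "D > 0" using Suc.prems by (simp add: D_def)
  have wn: "w n = kdet n a"
    unfolding w_def adj_mat_def cofactor_def mat_delete_def kdet_def
    by (simp add: power_add[symmetric] mult_2[symmetric], rule arg_cong[where f = det])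
      (auto intro!: eq_matI)
  have wn_pos: "w n > 0" using Suc.prems[of n] by (simp add: wn)
  have aw: "(\<Sum>j<Suc n. a i j * w j) = (if i = n then D else 0)" if "i < Suc n" for i
  proof -
    have "(?A * adj_mat ?A) $$ (i, n) = (\<Sum>j<Suc n. a i j * w j)"
      using that adj_mat(1)[of ?A "Suc n"]
      by (simp add: times_mat_def scalar_prod_def w_def atLeast0LessThan del: sum.lessThan_Suc)
    moreover have "(?A * adj_mat ?A) $$ (i, n) = (if i = n then D else 0)"
      using that adj_mat(2)[of ?A "Suc n"] by (simp add: D_def kdet_def)
    ultimately show ?thesis by simp
  qed
  show ?case
    unfolding pos_def_def
  proof (intro allI impI)
    fix v :: "nat \<Rightarrow> real" assume v: "\<exists>i\<in>{..<Suc n}. v i \<noteq> 0"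
    define s where "s = v n / w n"
    define u where "u i = v i - s * w i" for i
    have un: "u n = 0" using wn_pos by (simp add: u_def s_def)
    have "qform {..<Suc n} a v =
        (\<Sum>i<Suc n. \<Sum>j<Suc n. u i * u j * a i j + s * (u i * (a i j * w j)) + s * (u j * (a j i * w i))
          + s\<^sup>2 * (w i * (a i j * w j)))"
      unfolding qform_def
    proof (intro sum.cong refl)
      fix i j
      have "v i = u i + s * w i" "v j = u j + s * w j" by (simp_all add: u_def)
      then show "v i * v j * a i j = u i * u j * a i j + s * (u i * (a i j * w j))
          + s * (u j * (a j i * w i)) + s\<^sup>2 * (w i * (a i j * w j))"
        by (simp add: sym[of j i] algebra_simps power2_eq_square)
    qed
    also have "\<dots> = qform {..<Suc n} a u + s * (\<Sum>i<Suc n. u i * (\<Sum>j<Suc n. a i j * w j))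
        + s * (\<Sum>i<Suc n. \<Sum>j<Suc n. u j * (a j i * w i))
        + s\<^sup>2 * (\<Sum>i<Suc n. w i * (\<Sum>j<Suc n. a i j * w j))"
      unfolding qform_def sum.distrib sum_distrib_left ..
    also have "(\<Sum>i<Suc n. \<Sum>j<Suc n. u j * (a j i * w i)) = (\<Sum>i<Suc n. u i * (\<Sum>j<Suc n. a i j * w j))"
      unfolding sum_distrib_left by (rule sum.swap)
    also have "(\<Sum>i<Suc n. u i * (\<Sum>j<Suc n. a i j * w j)) = (\<Sum>i<Suc n. u i * (if i = n then D else 0))"
      by (intro sum.cong refl) (simp add: aw del: sum.lessThan_Suc)
    also have "\<dots> = 0" by (simp add: un)
    also have "(\<Sum>i<Suc n. w i * (\<Sum>j<Suc n. a i j * w j)) = (\<Sum>i<Suc n. w i * (if i = n then D else 0))"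
      by (intro sum.cong refl) (simp add: aw del: sum.lessThan_Suc)
    also have "\<dots> = w n * D" by simp
    also have "qform {..<Suc n} a u = qform {..<n} a u"
      unfolding qform_def by (simp add: un)
    finally have eq: "qform {..<Suc n} a v = qform {..<n} a u + s\<^sup>2 * (w n * D)" by simp
    show "qform {..<Suc n} a v > 0"
    proof (cases "s = 0")
      case False
      then have "s\<^sup>2 * (w n * D) > 0" using wn_pos D by simp
      then show ?thesis unfolding eq using pos_def_nonneg[OF IH, of u] by linarith
    next
      case True
      then have "v n = 0" using wn_pos by (simp add: s_def)
      then obtain i where "i < n" "v i \<noteq> 0" using v by (auto simp: less_Suc_eq)
      then have "qform {..<n} a u > 0" using True by (intro pos_defD[OF IH, of i]) (auto simp: u_def)
      then show ?thesis unfolding eq using True by simp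
    qed
  qed
qed

lemma pos_def_kdet_nonzero:
  assumes "pos_def {..<n} a"
  shows "kdet n a \<noteq> 0"
proof
  let ?A = "mat n n (\<lambda>(i, j). a i j)"
  assume "kdet n a = 0"
  then obtain v where v: "v \<in> carrier_vec n" "v \<noteq> 0\<^sub>v n" "?A *\<^sub>v v = 0\<^sub>v n"
    unfolding kdet_def using det_0_iff_vec_prod_zero[of ?A n] by auto
  have "\<exists>i<n. v $ i \<noteq> 0"
  proof (rule ccontr)
    assume "\<not> (\<exists>i<n. v $ i \<noteq> 0)"
    then have "v = 0\<^sub>v n" using v(1) by (intro eq_vecI) auto
    then show False using v(2) by simp
  qed
  then have "qform {..<n} a (\<lambda>i. v $ i) > 0" using pos_defD[OF assms] by blast
  moreover have "qform {..<n} a (\<lambda>i. v $ i) = (\<Sum>i<n. v $ i * (?A *\<^sub>v v) $ i)"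
    unfolding qform_def using v(1)
    by (intro sum.cong refl) (simp add: scalar_prod_def sum_distrib_left atLeast0LessThan mult_ac)
  ultimately show False using v(3) by simp
qed

text \<open>On the segment from the identity to \<open>a\<close> the forms stay positive definite,
  so the determinant never vanishes and keeps the sign it has at the identity.\<close>

lemma pos_def_kdet_pos:
  assumes "pos_def {..<n} a"
  shows "kdet n a > 0"
proof (rule ccontr)
  assume neg: "\<not> kdet n a > 0"
  define c where "c s i j = s * a i j + (1 - s) * (if i = j then 1 else 0)" for s and i j :: nat
  have "\<exists>s\<ge>0. s \<le> 1 \<and> kdet n (c s) = 0"
  proof (rule IVT2')
    have "kdet n (c 0) = det (1\<^sub>m n)"
      unfolding kdet_def c_def by (rule arg_cong[where f = det]) (auto intro!: eq_matI)
    then show "0 \<le> kdet n (c 0)" by simp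
    have "c 1 = a" by (intro ext) (simp add: c_def)
    then show "kdet n (c 1) \<le> 0" using neg by simp
    have "isCont (\<lambda>s. kdet n (c s)) s" for s
      unfolding isCont_def c_def by (rule tendsto_kdet) (intro tendsto_intros)
    then show "continuous_on {0..1} (\<lambda>s. kdet n (c s))"
      by (simp add: continuous_at_imp_continuous_on)
  qed simp
  then obtain s where s: "0 \<le> s" "s \<le> 1" "kdet n (c s) = 0" by blast
  have "pos_def {..<n} (c s)"
    unfolding pos_def_def
  proof (intro allI impI)
    fix v :: "nat \<Rightarrow> real" assume "\<exists>i\<in>{..<n}. v i \<noteq> 0"
    then obtain i where i: "i < n" "v i \<noteq> 0" by blast
    have "qform {..<n} (\<lambda>i j. if i = j then 1 else 0) v = (\<Sum>i<n. v i * v i)"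
      unfolding qform_def by (intro sum.cong refl) (simp add: if_distrib[where f = "\<lambda>t. _ * t"] cong: if_cong)
    then have eq: "qform {..<n} (c s) v = s * qform {..<n} a v + (1 - s) * (\<Sum>i<n. v i * v i)"
      unfolding c_def qform_add qform_smult by simp
    have 1: "qform {..<n} a v > 0" using pos_defD[OF assms] i by blast
    have 2: "(\<Sum>i<n. v i * v i) \<ge> v i * v i" using i by (intro member_le_sum) auto
    have 3: "v i * v i > 0" using i(2) by (metis not_square_less_zero mult_eq_0_iff linorder_cases)
    show "qform {..<n} (c s) v > 0"
    proof (cases "s = 0")
      case True
      then show ?thesis unfolding eq using 2 3 by simp
    next
      case False
      then show ?thesis unfolding eq using 1 2 3 s by (intro add_pos_nonneg) auto
    qed
  qed
  then show False using pos_def_kdet_nonzero s(3) by blast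
qed

lemma TP_powr_3:
  assumes "TP a 3 3" "\<alpha> \<ge> 1"
  shows "TP (\<lambda>i j. a i j powr \<alpha>) 3 3"
proof (rule TP_I)
  fix k p q assume p: "selects k 3 p" and q: "selects k 3 q"
  show "kdet k (\<lambda>i j. a (p i) (q j) powr \<alpha>) > 0"
    by (rule kdet_powr_pos[OF assms p q selects_le[OF p]])
qed

text \<open>The threshold is \<open>card S - 2\<close> in \<open>qform_powr\<close> for four
  indices. A selection of size 4 is the identity, so the quadratic form is needed for one minor
  only.\<close>

lemma TP_powr_4:
  assumes sym: "\<And>i j. a i j = a j i" and tp: "TP a 4 4" and "\<alpha> \<ge> 2"
  shows "TP (\<lambda>i j. a i j powr \<alpha>) 4 4"
proof (rule TP_I)
  fix k p q assume p: "selects k 4 p" and q: "selects k 4 q"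
  have k: "k \<le> 4" by (rule selects_le[OF p])
  show "kdet k (\<lambda>i j. a (p i) (q j) powr \<alpha>) > 0"
  proof (cases "k = 4")
    case True
    have "pos_def {..<4} a"
    proof (rule pos_def_leading_minors[OF sym])
      fix k :: nat assume "k \<le> 4"
      then show "kdet k a > 0" using TP_D[OF tp selects_id selects_id, of k] by simp
    qed
    then have "pos_def {..<4} (\<lambda>i j. a i j powr \<alpha>)"
      unfolding pos_def_def[of _ "\<lambda>i j. a i j powr \<alpha>"]
      using qform_powr[of "{..<4}" a \<alpha>] sym TP_pos[OF tp] assms(3) by simp
    then have "kdet 4 (\<lambda>i j. a i j powr \<alpha>) > 0" by (rule pos_def_kdet_pos)
    also have "kdet 4 (\<lambda>i j. a i j powr \<alpha>) = kdet k (\<lambda>i j. a (p i) (q j) powr \<alpha>)"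
      unfolding True
    proof (rule kdet_cong)
      fix i j :: nat assume "i < 4" "j < 4"
      then show "a i j powr \<alpha> = a (p i) (q j) powr \<alpha>"
        using selects_full[OF p[unfolded True], of i] selects_full[OF q[unfolded True], of j] by simp
    qed
    finally show ?thesis .
  next
    case False
    then show ?thesis using k assms(3) by (intro kdet_powr_pos[OF tp _ p q]) auto
  qed
qed

section \<open>Functions preserving total positivity\<close>

lemma TP_I_2:
  assumes pos: "\<And>i j. i < m \<Longrightarrow> j < 2 \<Longrightarrow> a i j > 0"
    and minor: "\<And>i k. i < k \<Longrightarrow> k < m \<Longrightarrow> a i 1 * a k 0 < a i 0 * a k 1"
  shows "TP a m 2"
proof (rule TP_I)
  fix k p q assume k: "k > 0" and p: "selects k m p" and q: "selects k 2 q"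
  have "k = Suc 0 \<or> k = 2" using k selects_le[OF q] by auto
  then show "kdet k (\<lambda>i j. a (p i) (q j)) > 0"
  proof
    assume "k = Suc 0"
    then show ?thesis using p q by (simp add: selects_def pos)
  next
    assume k2: "k = 2"
    have "p 0 < p 1" "p 1 < m" using p k2 by (simp_all add: selects_def)
    then show ?thesis
      using minor[of "p 0" "p 1"] selects_full[of 2 q 0] selects_full[of 2 q 1] q k2
      by (simp add: kdet_2)
  qed
qed

lemma TP_I_3:
  assumes pos: "\<And>i j. i < m \<Longrightarrow> j < 3 \<Longrightarrow> a i j > 0"
    and minor_2: "\<And>i k j l. i < k \<Longrightarrow> k < m \<Longrightarrow> j < l \<Longrightarrow> l < 3 \<Longrightarrow> a i l * a k j < a i j * a k l"
    and minor_3: "\<And>i j k. i < j \<Longrightarrow> j < k \<Longrightarrow> k < m \<Longrightarrow>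
      a i 0 * (a j 1 * a k 2 - a j 2 * a k 1) - a i 1 * (a j 0 * a k 2 - a j 2 * a k 0)
        + a i 2 * (a j 0 * a k 1 - a j 1 * a k 0) > 0"
  shows "TP a m 3"
proof (rule TP_I)
  fix k p q assume k: "k > 0" and p: "selects k m p" and q: "selects k 3 q"
  have "k = Suc 0 \<or> k = 2 \<or> k = 3" using k selects_le[OF q] by auto
  then show "kdet k (\<lambda>i j. a (p i) (q j)) > 0"
  proof (elim disjE)
    assume "k = Suc 0"
    then show ?thesis using p q by (simp add: selects_def pos)
  next
    assume k2: "k = 2"
    have "p 0 < p 1" "p 1 < m" "q 0 < q 1" "q 1 < 3"
      using p q k2 by (simp_all add: selects_def)
    then show ?thesis using minor_2[of "p 0" "p 1" "q 0" "q 1"] k2 by (simp add: kdet_2)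
  next
    assume k3: "k = 3"
    have "p 0 < p 1" "p 1 < p 2" "p 2 < m" using p k3 by (simp_all add: selects_def)
    then show ?thesis
      using minor_3[of "p 0" "p 1" "p 2"] selects_full[of 3 q 0] selects_full[of 3 q 1]
        selects_full[of 3 q 2] q k3
      by (simp add: kdet_3)
  qed
qed

section \<open>Sizes one and two\<close>

lemma preserves_1_iff: "preserves_TP_symmetric 1 F \<longleftrightarrow> (\<forall>x>0. F x > 0)"
proof -
  have iff: "TP a (Suc 0) (Suc 0) \<longleftrightarrow> a 0 0 > 0" for a
  proof
    assume "TP a (Suc 0) (Suc 0)"
    then show "a 0 0 > 0" by (rule TP_pos) simp_all
  next
    assume a: "a 0 0 > 0"
    show "TP a (Suc 0) (Suc 0)"
    proof (rule TP_I)
      fix k p q assume k: "k > 0" and p: "selects k (Suc 0) p" and q: "selects k (Suc 0) q"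
      have "k = Suc 0" using k selects_le[OF p] by simp
      then show "kdet k (\<lambda>i j. a (p i) (q j)) > 0" using p q a by (simp add: selects_def)
    qed
  qed
  show ?thesis
    unfolding preserves_TP_symmetric_iff One_nat_def iff
  proof (intro iffI allI impI)
    fix x :: real assume F: "\<forall>a. (\<forall>i j. a i j = a j i) \<longrightarrow> 0 < a 0 0 \<longrightarrow> 0 < F (a 0 0)" and "x > 0"
    then show "F x > 0" using F[rule_format, of "\<lambda>_ _. x"] by simp
  next
    fix a :: "nat \<Rightarrow> nat \<Rightarrow> real" assume "\<forall>x>0. F x > 0" "a 0 0 > 0"
    then show "F (a 0 0) > 0" by blast
  qed
qed

text \<open>A monotone function can only jump. For one-sided limits
  \<open>l \<le> F x \<le> L\<close>, the inequality with \<open>a\<close> left of \<open>x\<close>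
  and \<open>b\<close>, \<open>z\<close> right of it gives \<open>L^2 \<le> l * F z\<close>; letting
  \<open>z\<close> decrease to \<open>x\<close> yields \<open>L^2 \<le> l * L\<close>, so there is
  no jump. The strict hypothesis is what 2-by-2 test matrices supply before mid-convexity is
  known.\<close>

lemma continuous_on_of_strict_midconvex:
  fixes F :: "real \<Rightarrow> real"
  assumes pos: "\<And>x. x > 0 \<Longrightarrow> F x > 0" and mono: "strict_mono_on {0<..} F"
    and mid: "\<And>a b c. a > 0 \<Longrightarrow> b > 0 \<Longrightarrow> c > 0 \<Longrightarrow> b\<^sup>2 < a * c \<Longrightarrow> (F b)\<^sup>2 < F a * F c"
  shows "continuous_on {0<..} F"
proof -
  have less: "F x < F y" if "0 < x" "x < y" for x y
    using strict_mono_onD[OF mono, of x y] that by simp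
  have "isCont F x" if x: "x > 0" for x
  proof -
    define L where "L = Inf (F ` {x<..})"
    define l where "l = Sup (F ` {0<..<x})"
    have bL: "bdd_below (F ` {x<..})" using less[OF x] by (intro bdd_belowI2[of _ "F x"]) (simp add: less_imp_le)
    have bl: "bdd_above (F ` {0<..<x})" using less by (intro bdd_aboveI2[of _ _ "F x"]) (simp add: less_imp_le)
    have neL: "F ` {x<..} \<noteq> {}" using gt_ex[of x] by auto
    have nel: "F ` {0<..<x} \<noteq> {}" using dense[OF x] by auto
    have xL: "F x \<le> L" unfolding L_def using less[OF x] by (intro cInf_greatest neL) (auto simp: less_imp_le)
    have lx: "l \<le> F x" unfolding l_def using less by (intro cSup_least nel) (auto simp: less_imp_le)
    have Lpos: "L > 0" using xL pos[OF x] by simp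
    have L2: "L\<^sup>2 \<le> l * F z" if z: "x < z" for z
    proof -
      \<comment> \<open>Any \<open>a\<close> in this gap lies left of \<open>x\<close> and still
        satisfies \<open>x < sqrt (a * z)\<close>, which leaves room for \<open>b\<close> on the
        right of \<open>x\<close>.\<close>
      have "x\<^sup>2 / z < x" using x z by (simp add: power2_eq_square field_simps)
      then obtain a where a: "x\<^sup>2 / z < a" "a < x" using dense by blast
      have a0: "a > 0" using a(1) x z by (metis divide_pos_pos less_trans zero_less_power)
      have "x\<^sup>2 < a * z" using a(1) x z by (simp add: field_simps)
      then have "x < sqrt (a * z)" using x by (simp add: real_less_rsqrt)
      then obtain b where b: "x < b" "b < sqrt (a * z)" using dense by blast
      have "b\<^sup>2 < (sqrt (a * z))\<^sup>2" using b x by (intro power_strict_mono) auto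
      then have "b\<^sup>2 < a * z" using a0 x z by simp
      then have "(F b)\<^sup>2 < F a * F z" using mid[of a b z] a0 b x z by simp
      moreover have "L \<le> F b" unfolding L_def by (rule cInf_lower[OF _ bL]) (use b in auto)
      then have "L\<^sup>2 \<le> (F b)\<^sup>2" using Lpos by (intro power_mono) auto
      moreover have "F a \<le> l" unfolding l_def by (rule cSup_upper[OF _ bl]) (use a a0 in auto)
      then have "F a * F z \<le> l * F z" using pos[of z] x z by (intro mult_right_mono) auto
      ultimately show ?thesis by linarith
    qed
    obtain z0 where "x < z0" using gt_ex by blast
    have lpos: "l > 0"
    proof -
      have "0 < l * F z0" using L2[OF \<open>x < z0\<close>] Lpos by (metis less_le_trans zero_less_power)
      then show ?thesis using pos[of z0] \<open>x < z0\<close> x by (simp add: zero_less_mult_iff)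
    qed
    have "L\<^sup>2 / l \<le> L"
      unfolding L_def
    proof (rule cInf_greatest[OF neL])
      fix y assume "y \<in> F ` {x<..}"
      then show "(Inf (F ` {x<..}))\<^sup>2 / l \<le> y"
        using L2 lpos unfolding L_def[symmetric] by (auto simp: field_simps)
    qed
    then have "L \<le> l" using lpos Lpos by (simp add: field_simps power2_eq_square)
    then have Ll: "L = F x" "l = F x" using xL lx by auto
    show "isCont F x"
      unfolding isCont_def
    proof (rule order_tendstoI)
      fix u assume "u < F x"
      then obtain z where z: "0 < z" "z < x" "u < F z"
        using less_cSup_iff[OF nel bl] unfolding l_def[symmetric] Ll(2) by auto
      have "\<forall>\<^sub>F y in at x. z < y" using z(2) by (rule order_tendstoD(1)[OF tendsto_ident_at])
      then show "\<forall>\<^sub>F y in at x. u < F y"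
        by eventually_elim (use z less in \<open>meson less_trans\<close>)
    next
      fix u assume "F x < u"
      then obtain z where z: "x < z" "F z < u"
        using cInf_less_iff[OF neL bL] unfolding L_def[symmetric] Ll(1) by auto
      have "\<forall>\<^sub>F y in at x. y < z" "\<forall>\<^sub>F y in at x. 0 < y"
        using z(1) x by (auto intro: order_tendstoD[OF tendsto_ident_at])
      then show "\<forall>\<^sub>F y in at x. F y < u"
        by eventually_elim (use z less in \<open>meson less_trans\<close>)
    qed
  qed
  then show ?thesis by (intro continuous_at_imp_continuous_on) auto
qed

lemma mult_midconvex_strict:
  assumes "strict_mono_on {0<..} F" "\<forall>x>0. F x > 0" "mult_midconvex F"
    "a > 0" "b > 0" "c > 0" "b\<^sup>2 < a * c"
  shows "(F b)\<^sup>2 < F a * F c"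
proof -
  have "b < sqrt (a * c)" using assms(5,7) by (simp add: real_less_rsqrt)
  then have "F b < F (sqrt (a * c))" using strict_mono_onD[OF assms(1), of b] assms(5) by simp
  then have "(F b)\<^sup>2 < (F (sqrt (a * c)))\<^sup>2" using assms(2,5) by (intro power_strict_mono) (auto simp: less_imp_le)
  also have "\<dots> \<le> F a * F c" using assms(3,4,6) by (simp add: mult_midconvex_def)
  finally show ?thesis .
qed

lemma continuous_on_of_mult_midconvex:
  assumes "\<forall>x>0. F x > 0" "strict_mono_on {0<..} F" "mult_midconvex F"
  shows "continuous_on {0<..} F"
  using assms by (intro continuous_on_of_strict_midconvex mult_midconvex_strict[of F]) auto

lemma preserves_2_strict:
  assumes F: "preserves_TP_symmetric 2 F" and abc: "a > 0" "b > 0" "c > 0" "b\<^sup>2 < a * c"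
  shows "(F b)\<^sup>2 < F a * F c"
proof -
  define A where "A i j = (if i \<noteq> j then b else if i = 0 then a else c)" for i j :: nat
  have "TP A 2 2"
    by (rule TP_I_2) (use abc in \<open>auto simp: A_def power2_eq_square less_Suc_eq numeral_2_eq_2\<close>)
  moreover have "\<forall>i j. A i j = A j i" by (simp add: A_def)
  ultimately have "TP (\<lambda>i j. F (A i j)) 2 2" using F unfolding preserves_TP_symmetric_iff by blast
  from TP_minor_2[OF this, of 0 1 0 1] show ?thesis by (simp add: A_def power2_eq_square)
qed

lemma preserves_2_iff:
  "preserves_TP_symmetric 2 F \<longleftrightarrow>
     (\<forall>x>0. F x > 0) \<and> strict_mono_on {0<..} F \<and> mult_midconvex F"
proof (intro iffI conjI)
  assume F: "preserves_TP_symmetric 2 F"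
  show pos: "\<forall>x>0. F x > 0"
    using preserves_TP_symmetric_le[OF F, of 1] preserves_1_iff by simp
  note mid = preserves_2_strict[OF F]
  show mono: "strict_mono_on {0<..} F"
  proof (rule strict_mono_onI)
    fix x y :: real assume "x \<in> {0<..}" "y \<in> {0<..}" "x < y"
    \<comment> \<open>The test matrix has \<open>y\<close> on the diagonal and \<open>x\<close> off
      it.\<close>
    then have "(F x)\<^sup>2 < (F y)\<^sup>2"
      using mid[of y x y] by (simp add: power2_eq_square mult_strict_mono)
    then show "F x < F y" by (rule power2_less_imp_less) (use pos \<open>y \<in> _\<close> in \<open>simp add: less_imp_le\<close>)
  qed
  \<comment> \<open>Test matrices reach only \<open>b < sqrt (x * y)\<close>; the inequality at the
    geometric mean itself is a left limit, so continuity has to come first.\<close>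
  have cont: "continuous_on {0<..} F"
    by (rule continuous_on_of_strict_midconvex[OF _ mono mid]) (simp add: pos)
  show "mult_midconvex F"
    unfolding mult_midconvex_def
  proof (intro allI impI)
    fix x y :: real assume xy: "0 < x" "0 < y"
    define s where "s = sqrt (x * y)"
    have s: "s > 0" "s\<^sup>2 = x * y" using xy by (simp_all add: s_def)
    have "isCont F s" using cont s(1) by (simp add: continuous_on_eq_continuous_at)
    then have "(F \<longlongrightarrow> F s) (at_left s)" unfolding isCont_def by (rule filterlim_at_split[THEN iffD1, THEN conjunct1])
    then have "((\<lambda>b. (F b)\<^sup>2) \<longlongrightarrow> (F s)\<^sup>2) (at_left s)" by (intro tendsto_intros)
    moreover have "\<forall>\<^sub>F b in at_left s. (F b)\<^sup>2 \<le> F x * F y"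
      using eventually_at_left_real[OF s(1)]
    proof eventually_elim
      case (elim b)
      then have "b\<^sup>2 < s\<^sup>2" by (intro power_strict_mono) auto
      then show ?case using mid[of x b y] xy elim s(2) by simp
    qed
    ultimately show "(F (sqrt (x * y)))\<^sup>2 \<le> F x * F y"
      unfolding s_def[symmetric] by (rule tendsto_upperbound) simp
  qed
next
  assume F: "(\<forall>x>0. F x > 0) \<and> strict_mono_on {0<..} F \<and> mult_midconvex F"
  show "preserves_TP_symmetric 2 F"
    unfolding preserves_TP_symmetric_iff
  proof (intro allI impI)
    fix a :: "nat \<Rightarrow> nat \<Rightarrow> real" assume a: "\<forall>i j. a i j = a j i" "TP a 2 2"
    have pos: "a i j > 0" if "i < 2" "j < 2" for i j using TP_pos[OF a(2)] that by blast
    show "TP (\<lambda>i j. F (a i j)) 2 2"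
    proof (rule TP_I_2)
      fix i k :: nat assume "i < k" "k < 2"
      then have ik: "i = 0" "k = 1" by auto
      have "(a 0 1)\<^sup>2 < a 0 0 * a 1 1"
        using TP_minor_2[OF a(2), of 0 1 0 1] a(1)[rule_format, of 1 0] by (simp add: power2_eq_square)
      then have "(F (a 0 1))\<^sup>2 < F (a 0 0) * F (a 1 1)"
        using F pos[of 0 0] pos[of 0 1] pos[of 1 1] by (simp add: mult_midconvex_strict)
      then show "F (a i 1) * F (a k 0) < F (a i 0) * F (a k 1)"
        using a(1)[rule_format, of 1 0] unfolding ik by (simp add: power2_eq_square)
    qed (use F pos in auto)
  qed
qed

section \<open>From 3-by-3 test matrices to power functions\<close>

lemma additive_mono_imp_linear:
  fixes G :: "real \<Rightarrow> real"
  assumes add: "\<And>x y. G (x + y) = G x + G y" and mono: "\<And>x y. x \<le> y \<Longrightarrow> G x \<le> G y"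
  shows "G x = x * G 1"
proof -
  \<comment> \<open>\<open>H\<close> is additive and vanishes at the integers, so it has period 1
    and, by monotonicity of \<open>G\<close>, is bounded. A nonzero value would be unbounded along
    its multiples.\<close>
  define H where "H x = G x - x * G 1" for x
  have H_add: "H (x + y) = H x + H y" for x y by (simp add: H_def add algebra_simps)
  have H0: "H 0 = 0" using H_add[of 0 0] by simp
  have H_nat: "H (of_nat n * x) = of_nat n * H x" for n x
    by (induction n) (simp_all add: H0 H_add algebra_simps)
  have H_neg: "H (- x) = - H x" for x using H_add[of x "- x"] H0 by simp
  have H_int: "H (of_int m) = 0" for m
  proof -
    have "H 1 = 0" by (simp add: H_def)
    then have "H (of_nat n) = 0" for n using H_nat[of n 1] by simp
    then show ?thesis by (cases m rule: int_cases2) (simp_all add: H_neg)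
  qed
  have G0: "G 0 = 0" using add[of 0 0] by simp
  have G1: "G 1 \<ge> 0" using mono[of 0 1] G0 by simp
  have bound: "\<bar>H y\<bar> \<le> G 1" for y
  proof -
    have f: "0 \<le> frac y" "frac y \<le> 1" using frac_lt_1[of y] by simp_all
    have "H y = H (of_int \<lfloor>y\<rfloor>) + H (frac y)" using H_add[of "of_int \<lfloor>y\<rfloor>" "frac y"] by (simp add: frac_def)
    then have "H y = G (frac y) - frac y * G 1" by (simp add: H_int) (simp add: H_def)
    moreover have "0 \<le> G (frac y)" "G (frac y) \<le> G 1" using mono f G0 by metis+
    moreover have "0 \<le> frac y * G 1" "frac y * G 1 \<le> G 1" using f G1 by (simp_all add: mult_left_le_one_le)
    ultimately show ?thesis by linarith
  qed
  have "H x = 0"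
  proof (rule ccontr)
    assume "H x \<noteq> 0"
    then obtain n where "G 1 < of_nat n * \<bar>H x\<bar>" using ex_less_of_nat_mult[of "\<bar>H x\<bar>" "G 1"] by auto
    also have "\<dots> = \<bar>H (of_nat n * x)\<bar>" by (simp add: H_nat abs_mult)
    finally show False using bound[of "of_nat n * x"] by simp
  qed
  then show ?thesis by (simp add: H_def)
qed

lemma multiplicative_imp_powr:
  fixes F :: "real \<Rightarrow> real"
  assumes pos: "\<And>x. x > 0 \<Longrightarrow> F x > 0" and mono: "strict_mono_on {0<..} F"
    and mult: "\<And>x y. x > 0 \<Longrightarrow> y > 0 \<Longrightarrow> F (x * y) * F 1 = F x * F y"
  shows "\<exists>c \<alpha>. c > 0 \<and> \<alpha> > 0 \<and> (\<forall>x>0. F x = c * x powr \<alpha>)"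
proof -
  define G where "G s = ln (F (exp s) / F 1)" for s
  have F1: "F 1 > 0" by (simp add: pos)
  have less: "F x < F y" if "0 < x" "x < y" for x y
    using strict_mono_onD[OF mono, of x y] that by simp
  have "G (x + y) = G x + G y" for x y
  proof -
    have "F (exp (x + y)) / F 1 = (F (exp x) / F 1) * (F (exp y) / F 1)"
      using mult[of "exp x" "exp y"] F1 by (simp add: exp_add field_simps)
    then show ?thesis using F1 pos[of "exp x"] pos[of "exp y"] by (simp add: G_def ln_mult ln_div)
  qed
  moreover have G_less: "G x < G y" if "x < y" for x y
    using less[of "exp x" "exp y"] that F1 pos by (simp add: G_def divide_strict_right_mono)
  then have "G x \<le> G y" if "x \<le> y" for x y using that by (cases "x = y") (auto simp: less_imp_le)
  ultimately have G: "G s = s * G 1" for s by (intro additive_mono_imp_linear)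
  have "F x = F 1 * x powr G 1" if x: "x > 0" for x
  proof -
    have "x powr G 1 = exp (G (ln x))" using x G[of "ln x"] by (simp add: powr_def mult.commute)
    also have "\<dots> = F x / F 1" using x pos F1 by (simp add: G_def)
    finally show ?thesis using F1 by simp
  qed
  moreover have "G 1 > 0" using G_less[of 0 1] G[of 0] by simp
  ultimately show ?thesis using F1 by blast
qed

text \<open>Prescribing rows 0, 1 and columns 1, 2 leaves the two outer diagonal entries free. Both
  are set to one large \<open>s\<close>, which gives rows \<open>s x y\<close>,
  \<open>x z w\<close>, \<open>y w s\<close>.\<close>

lemma ex_symmetric_TP_3:
  fixes x y z w :: real
  assumes pos: "x > 0" "y > 0" "z > 0" "w > 0" and minor: "y * z < x * w"
  shows "\<exists>a. (\<forall>i j. a i j = a j i) \<and> TP a 3 3 \<and> a 0 1 = x \<and> a 0 2 = y \<and> a 1 1 = z \<and> a 1 2 = w"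
proof -
  \<comment> \<open>The first five bounds give the 2-by-2 minors other than the prescribed one. The
    last two give the determinant: the extra 1 leaves a summand \<open>s\<close> to absorb
    \<open>y^2 * z\<close>.\<close>
  have "\<forall>\<^sub>F s in at_top. x\<^sup>2 / z < s \<and> x * y / w < s \<and> y < s \<and> y * w / x < s \<and> w\<^sup>2 / z < s \<and>
      (w\<^sup>2 + x\<^sup>2 + 1) / z < s \<and> y\<^sup>2 * z < s"
    by (intro eventually_conj eventually_gt_at_top)
  then obtain s where s: "x\<^sup>2 / z < s" "x * y / w < s" "y < s" "y * w / x < s" "w\<^sup>2 / z < s"
      "(w\<^sup>2 + x\<^sup>2 + 1) / z < s" "y\<^sup>2 * z < s"
    using eventually_happens[of _ "at_top :: real filter"] by (auto simp: trivial_limit_at_top_linorder)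
  have s0: "s > 0" using s(3) pos by simp
  have m: "x * x < s * z" "x * y < s * w" "y * y < s * s" "y * w < s * x" "w * w < s * z"
    using s pos s0 mult_strict_mono[of y s y s] by (simp_all add: field_simps power2_eq_square)
  have "w\<^sup>2 + x\<^sup>2 + 1 < s * z" using s(6) pos by (simp add: field_simps)
  then have "s * (w\<^sup>2 + x\<^sup>2 + 1) < s * (s * z)" using s0 by (rule mult_strict_left_mono)
  moreover have "0 < x * y * w" using pos by simp
  moreover have "s * (z * s - w * w) - x * (x * s - w * y) + y * (x * w - z * y) =
      (s * (s * z) - s * (w\<^sup>2 + x\<^sup>2 + 1)) + (s - y\<^sup>2 * z) + 2 * (x * y * w)"
    by (simp add: algebra_simps power2_eq_square)
  ultimately have det: "0 < s * (z * s - w * w) - x * (x * s - w * y) + y * (x * w - z * y)"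
    using s(7) by linarith
  define r where "r i = (if i = 0 then [s, x, y] else if i = 1 then [x, z, w] else [y, w, s])" for i :: nat
  define a where "a i j = (if i < 3 \<and> j < 3 then r i ! j else 0)" for i j
  have a: "a 0 0 = s" "a 0 1 = x" "a 0 2 = y" "a 1 0 = x" "a 1 1 = z" "a 1 2 = w"
    "a 2 0 = y" "a 2 1 = w" "a 2 2 = s"
    by (simp_all add: a_def r_def)
  have lt3: "i = 0 \<or> i = 1 \<or> i = 2" if "i < 3" for i :: nat using that by auto
  have lt3': "(i = 0 \<and> k = 1) \<or> (i = 0 \<and> k = 2) \<or> (i = 1 \<and> k = 2)" if "i < k" "k < 3" for i k :: nat
    using that by auto
  have "TP a 3 3"
  proof (rule TP_I_3)
    fix i j :: nat assume "i < 3" "j < 3"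
    then show "a i j > 0" using lt3[of i] lt3[of j] pos s0 a by metis
  next
    fix i k j l :: nat assume *: "i < k" "k < 3" "j < l" "l < 3"
    show "a i l * a k j < a i j * a k l"
      using lt3'[OF *(1,2)] lt3'[OF *(3,4)] m minor pos
      by (elim disjE conjE) (simp_all only: a mult.commute)
  next
    fix i j k :: nat assume "i < j" "j < k" "k < 3"
    then have "i = 0" "j = 1" "k = 2" by auto
    then show "a i 0 * (a j 1 * a k 2 - a j 2 * a k 1) - a i 1 * (a j 0 * a k 2 - a j 2 * a k 0)
        + a i 2 * (a j 0 * a k 1 - a j 1 * a k 0) > 0"
      using det by (simp only: a)
  qed
  moreover have "a i j = a j i" for i j
  proof (cases "i < 3 \<and> j < 3")
    case True
    then show ?thesis using lt3[of i] lt3[of j] a by metis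
  qed (auto simp: a_def)
  ultimately show ?thesis using a by blast
qed

lemma preserves_3_powr:
  assumes F: "preserves_TP_symmetric 3 F"
  shows "\<exists>c \<alpha>. c > 0 \<and> \<alpha> > 0 \<and> (\<forall>x>0. F x = c * x powr \<alpha>)"
proof -
  have F2: "(\<forall>x>0. F x > 0) \<and> strict_mono_on {0<..} F \<and> mult_midconvex F"
    using preserves_TP_symmetric_le[OF F, of 2] preserves_2_iff by simp
  then have cont: "isCont F x" if "x > 0" for x
    using continuous_on_of_mult_midconvex[of F] that by (simp add: continuous_on_eq_continuous_at)
  have strict: "F y * F z < F x * F w" if "x > 0" "y > 0" "z > 0" "w > 0" "y * z < x * w" for x y z w
  proof -
    from ex_symmetric_TP_3[OF that]
    obtain a where a: "\<forall>i j. a i j = a j i" "TP a 3 3" "a 0 1 = x" "a 0 2 = y" "a 1 1 = z" "a 1 2 = w"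
      by blast
    have "TP (\<lambda>i j. F (a i j)) 3 3" using F a(1,2) unfolding preserves_TP_symmetric_iff by blast
    from TP_minor_2[OF this, of 0 1 1 2] show ?thesis using a by simp
  qed
  \<comment> \<open>Raising \<open>x\<close> slightly makes the comparison of products strict, and
    continuity brings it back. Used in both directions, this is multiplicativity up to the factor
    \<open>F 1\<close>.\<close>
  have le: "F y * F z \<le> F x * F w" if xyzw: "x > 0" "y > 0" "z > 0" "w > 0" "y * z = x * w" for x y z w
  proof -
    have "(F \<longlongrightarrow> F x) (at_right x)" using cont[OF xyzw(1)] unfolding isCont_def
      by (rule filterlim_at_split[THEN iffD1, THEN conjunct2])
    then have "((\<lambda>t. F t * F w) \<longlongrightarrow> F x * F w) (at_right x)" by (intro tendsto_intros)
    moreover have "\<forall>\<^sub>F t in at_right x. F y * F z \<le> F t * F w"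
      using eventually_at_right_less
    proof eventually_elim
      case (elim t)
      then show ?case using strict[of t y z w] xyzw by simp
    qed
    ultimately show ?thesis by (rule tendsto_lowerbound) simp
  qed
  show ?thesis
  proof (rule multiplicative_imp_powr)
    fix x y :: real assume "x > 0" "y > 0"
    then show "F (x * y) * F 1 = F x * F y"
      using le[of x "x * y" 1 y] le[of "x * y" x y 1] by simp
  qed (use F2 in auto)
qed

text \<open>A positive combination of the rank-one kernels \<open>\<phi> i l * \<phi> j l\<close> with \<open>l < n\<close> is a limit of
  totally positive symmetric matrices: extend \<open>\<phi>\<close> to \<open>d\<close> columns and give the new ones weight
  \<open>\<epsilon>\<close>.\<close>

lemma gram_limit:
  assumes "TP \<phi> d n" "n \<le> d" "\<And>l. l < n \<Longrightarrow> w l > 0"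
  obtains A where "\<And>\<epsilon> i j. A \<epsilon> i j = A \<epsilon> j i" "\<And>\<epsilon>. \<epsilon> > 0 \<Longrightarrow> TP (A \<epsilon>) d d"
    "\<And>i j. ((\<lambda>\<epsilon>. A \<epsilon> i j) \<longlongrightarrow> (\<Sum>l<n. w l * \<phi> i l * \<phi> j l)) (at_right (0::real))"
proof -
  obtain \<Phi> where \<Phi>: "\<forall>i j. j < n \<longrightarrow> \<Phi> i j = \<phi> i j" "TP \<Phi> d d"
    using TP_extend_columns[OF assms(1,2)] by blast
  define W where "W \<epsilon> l = (if l < n then w l else \<epsilon>)" for \<epsilon> l
  define A where "A \<epsilon> i j = (\<Sum>l<d. W \<epsilon> l * \<Phi> i l * \<Phi> j l)" for \<epsilon> i j
  have "A \<epsilon> i j = A \<epsilon> j i" for \<epsilon> i j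
    unfolding A_def by (intro sum.cong refl) simp
  moreover have "TP (A \<epsilon>) d d" if "\<epsilon> > 0" for \<epsilon>
    using TP_gram[OF \<Phi>(2), of "W \<epsilon>"] that assms(3) by (simp add: A_def[abs_def] W_def)
  moreover have "((\<lambda>\<epsilon>. A \<epsilon> i j) \<longlongrightarrow> (\<Sum>l<n. w l * \<phi> i l * \<phi> j l)) (at_right 0)" for i j
  proof -
    have "((\<lambda>\<epsilon>. W \<epsilon> l * \<Phi> i l * \<Phi> j l) \<longlongrightarrow> W 0 l * \<Phi> i l * \<Phi> j l) (at_right 0)" for l
      unfolding W_def by (cases "l < n") (auto intro!: tendsto_eq_intros)
    then have "((\<lambda>\<epsilon>. A \<epsilon> i j) \<longlongrightarrow> (\<Sum>l<d. W 0 l * \<Phi> i l * \<Phi> j l)) (at_right 0)"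
      unfolding A_def by (intro tendsto_sum)
    also have "(\<Sum>l<d. W 0 l * \<Phi> i l * \<Phi> j l) = (\<Sum>l<n. W 0 l * \<Phi> i l * \<Phi> j l)"
      using assms(2) by (intro sum.mono_neutral_right) (auto simp: W_def)
    also have "\<dots> = (\<Sum>l<n. w l * \<phi> i l * \<phi> j l)"
      using \<Phi>(1) by (intro sum.cong) (auto simp: W_def)
    finally show ?thesis .
  qed
  ultimately show ?thesis by (rule that)
qed

lemma gram_powr_limit:
  assumes F: "preserves_TP_symmetric d F" "c > 0" "\<And>x. x > 0 \<Longrightarrow> F x = c * x powr \<alpha>"
    and tp: "TP \<phi> d n" and n: "0 < n" "n \<le> d" and w: "\<And>l. l < n \<Longrightarrow> w l > 0"
  obtains B where "\<And>\<epsilon> i j. \<epsilon> > 0 \<Longrightarrow> B \<epsilon> i j = B \<epsilon> j i" "\<And>\<epsilon>. \<epsilon> > 0 \<Longrightarrow> TP (B \<epsilon>) d d"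
    "\<And>i j. i < d \<Longrightarrow> j < d \<Longrightarrow>
      ((\<lambda>\<epsilon>. B \<epsilon> i j) \<longlongrightarrow> (\<Sum>l<n. w l * \<phi> i l * \<phi> j l) powr \<alpha>) (at_right (0::real))"
proof -
  obtain A where A: "\<And>\<epsilon> i j. A \<epsilon> i j = A \<epsilon> j i" "\<And>\<epsilon>. \<epsilon> > 0 \<Longrightarrow> TP (A \<epsilon>) d d"
    and lim: "\<And>i j. ((\<lambda>\<epsilon>. A \<epsilon> i j) \<longlongrightarrow> (\<Sum>l<n. w l * \<phi> i l * \<phi> j l)) (at_right (0::real))"
  proof (rule gram_limit[of \<phi> d n w])
    fix A assume "\<And>\<epsilon> i j. A \<epsilon> i j = A \<epsilon> j i" "\<And>\<epsilon>. \<epsilon> > 0 \<Longrightarrow> TP (A \<epsilon>) d d"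
      "\<And>i j. ((\<lambda>\<epsilon>. A \<epsilon> i j) \<longlongrightarrow> (\<Sum>l<n. w l * \<phi> i l * \<phi> j l)) (at_right (0::real))"
    then show thesis by (rule that)
  qed (use tp n(2) w in auto)
  define B where "B \<epsilon> i j = A \<epsilon> i j powr \<alpha>" for \<epsilon> i j
  have "B \<epsilon> i j = B \<epsilon> j i" for \<epsilon> i j unfolding B_def by (simp only: A(1)[of \<epsilon> i j])
  moreover have "TP (B \<epsilon>) d d" if "\<epsilon> > 0" for \<epsilon>
  proof -
    have T: "TP (A \<epsilon>) d d" by (rule A(2)[OF that])
    then have "TP (\<lambda>i j. F (A \<epsilon> i j)) d d"
      using F(1)[unfolded preserves_TP_symmetric_iff, rule_format, of "A \<epsilon>"] A(1) by blast
    then have "TP (\<lambda>i j. (1 / c) * 1 * F (A \<epsilon> i j)) d d"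
      by (rule TP_scale) (use F(2) in simp_all)
    then show ?thesis
      by (rule TP_cong_imp) (use TP_pos[OF T] F(2,3) in \<open>simp add: B_def\<close>)
  qed
  moreover have "((\<lambda>\<epsilon>. B \<epsilon> i j) \<longlongrightarrow> (\<Sum>l<n. w l * \<phi> i l * \<phi> j l) powr \<alpha>) (at_right 0)"
    if "i < d" "j < d" for i j
  proof -
    have "(\<Sum>l<n. w l * \<phi> i l * \<phi> j l) > 0"
      using n w TP_pos[OF tp] that by (intro sum_pos) auto
    then show ?thesis unfolding B_def by (intro tendsto_powr lim tendsto_const) simp
  qed
  ultimately show ?thesis by (rule that)
qed

section \<open>Lower bounds for the exponent from low-rank kernels\<close>

lemma tendsto_qform:
  assumes "\<And>i j. i \<in> S \<Longrightarrow> j \<in> S \<Longrightarrow> ((\<lambda>x. f x i j) \<longlongrightarrow> g i j) \<F>"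
  shows "((\<lambda>x. qform S (f x) v) \<longlongrightarrow> qform S g v) \<F>"
  unfolding qform_def by (intro tendsto_sum tendsto_mult tendsto_const assms)

text \<open>Positive leading minors make each approximant positive definite, and the form survives
  the limit. A form is more useful here than a determinant, since a finite-difference vector
  \<open>v\<close> isolates one Taylor coefficient.\<close>

lemma gram_powr_qform_nonneg:
  assumes "preserves_TP_symmetric d F" "c > 0" "\<And>x. x > 0 \<Longrightarrow> F x = c * x powr \<alpha>"
    and "TP \<phi> d n" "0 < n" "n \<le> d" "\<And>l. l < n \<Longrightarrow> w l > 0"
  shows "qform {..<d} (\<lambda>i j. (\<Sum>l<n. w l * \<phi> i l * \<phi> j l) powr \<alpha>) v \<ge> 0"
proof -
  obtain B where B: "\<And>\<epsilon> i j. \<epsilon> > 0 \<Longrightarrow> B \<epsilon> i j = B \<epsilon> j i" "\<And>\<epsilon>. \<epsilon> > 0 \<Longrightarrow> TP (B \<epsilon>) d d"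
    and lim: "\<And>i j. i < d \<Longrightarrow> j < d \<Longrightarrow>
      ((\<lambda>\<epsilon>. B \<epsilon> i j) \<longlongrightarrow> (\<Sum>l<n. w l * \<phi> i l * \<phi> j l) powr \<alpha>) (at_right (0::real))"
  proof (rule gram_powr_limit[of d F c \<alpha> \<phi> n w])
    fix B assume "\<And>\<epsilon> i j. \<epsilon> > 0 \<Longrightarrow> B \<epsilon> i j = B \<epsilon> j i" "\<And>\<epsilon>. \<epsilon> > 0 \<Longrightarrow> TP (B \<epsilon>) d d"
      "\<And>i j. i < d \<Longrightarrow> j < d \<Longrightarrow>
        ((\<lambda>\<epsilon>. B \<epsilon> i j) \<longlongrightarrow> (\<Sum>l<n. w l * \<phi> i l * \<phi> j l) powr \<alpha>) (at_right (0::real))"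
    then show thesis by (rule that)
  qed (use assms in auto)
  have "((\<lambda>\<epsilon>. qform {..<d} (B \<epsilon>) v) \<longlongrightarrow>
      qform {..<d} (\<lambda>i j. (\<Sum>l<n. w l * \<phi> i l * \<phi> j l) powr \<alpha>) v) (at_right 0)"
    by (rule tendsto_qform) (simp add: lim)
  moreover have "\<forall>\<^sub>F \<epsilon> in at_right 0. 0 \<le> qform {..<d} (B \<epsilon>) v"
    using eventually_at_right_less
  proof eventually_elim
    case (elim \<epsilon>)
    have "pos_def {..<d} (B \<epsilon>)"
    proof (rule pos_def_leading_minors)
      show "B \<epsilon> i j = B \<epsilon> j i" for i j by (rule B(1)[OF elim])
      fix k assume "k \<le> d"
      then show "kdet k (B \<epsilon>) > 0"
        using TP_D[OF B(2)[OF elim] selects_id selects_id, of k] by simp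
    qed
    then show ?case by (rule pos_def_nonneg)
  qed
  ultimately show ?thesis by (rule tendsto_lowerbound) simp
qed

text \<open>The form of the array (1 + t x_i x_j)^\<alpha> at x = 1, 2, 3 and v = (1, -2, 1), with
  equal products collected. Its t^k coefficient is binom(\<alpha>,k) times the square of the sum of
  v_i x_i^k; second differences kill k = 0, 1, and k = 2 gives 4 binom(\<alpha>,2).\<close>

lemma powr_second_difference:
  fixes \<alpha> :: real
  shows "((\<lambda>t. ((1 + t) powr \<alpha> - 4 * (1 + 2 * t) powr \<alpha> + 2 * (1 + 3 * t) powr \<alpha>
      + 4 * (1 + 4 * t) powr \<alpha> - 4 * (1 + 6 * t) powr \<alpha> + (1 + 9 * t) powr \<alpha>) / t ^ 2)
    \<longlongrightarrow> 2 * \<alpha> * (\<alpha> - 1)) (at_right 0)"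
  by (real_asymp simp: field_simps)

text \<open>The same with x = 1, 2, 3, 4 and v = (1, -3, 3, -1): third differences kill k = 0, 1, 2,
  and k = 3 gives 36 binom(\<alpha>,3).\<close>

lemma powr_third_difference:
  fixes \<alpha> :: real
  shows "((\<lambda>t. ((1 + t) powr \<alpha> - 6 * (1 + 2 * t) powr \<alpha> + 6 * (1 + 3 * t) powr \<alpha>
      + 7 * (1 + 4 * t) powr \<alpha> - 18 * (1 + 6 * t) powr \<alpha> + 6 * (1 + 8 * t) powr \<alpha>
      + 9 * (1 + 9 * t) powr \<alpha> - 6 * (1 + 12 * t) powr \<alpha> + (1 + 16 * t) powr \<alpha>) / t ^ 3)
    \<longlongrightarrow> 6 * \<alpha> * (\<alpha> - 1) * (\<alpha> - 2)) (at_right 0)"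
  by (real_asymp simp: field_simps)

lemma TP_affine: "TP (\<lambda>i l. if l = 0 then 1 else real i + 1) m 2"
  by (rule TP_I_2) auto

lemma preserves_3_exponent:
  assumes "preserves_TP_symmetric 3 F" "c > 0" "\<alpha> > 0" "\<And>x. x > 0 \<Longrightarrow> F x = c * x powr \<alpha>"
  shows "\<alpha> \<ge> 1"
proof -
  have "\<forall>\<^sub>F t::real in at_right 0. 0 \<le> ((1 + t) powr \<alpha> - 4 * (1 + 2 * t) powr \<alpha> + 2 * (1 + 3 * t) powr \<alpha>
      + 4 * (1 + 4 * t) powr \<alpha> - 4 * (1 + 6 * t) powr \<alpha> + (1 + 9 * t) powr \<alpha>) / t ^ 2"
    using eventually_at_right_less
  proof eventually_elim
    case (elim t)
    have "0 \<le> qform {..<3} (\<lambda>i j. (\<Sum>l<2::nat. (if l = 0 then 1 else t) *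
        (if l = 0 then 1 else real i + 1) * (if l = 0 then 1 else real j + 1)) powr \<alpha>)
        (\<lambda>i. [1, -2, 1] ! i)"
      by (rule gram_powr_qform_nonneg[OF assms(1,2,4) TP_affine]) (use elim in auto)
    then show ?case
      by (intro divide_nonneg_nonneg) (simp_all add: qform_def eval_nat_numeral algebra_simps)
  qed
  then have "0 \<le> 2 * \<alpha> * (\<alpha> - 1)" by (rule tendsto_lowerbound[OF powr_second_difference]) simp
  then show ?thesis using assms(3) by (simp add: zero_le_mult_iff)
qed

lemma preserves_4_exponent:
  assumes "preserves_TP_symmetric 4 F" "c > 0" "\<alpha> \<ge> 1" "\<And>x. x > 0 \<Longrightarrow> F x = c * x powr \<alpha>"
  shows "\<alpha> = 1 \<or> \<alpha> \<ge> 2"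
proof -
  have "\<forall>\<^sub>F t::real in at_right 0. 0 \<le> ((1 + t) powr \<alpha> - 6 * (1 + 2 * t) powr \<alpha> + 6 * (1 + 3 * t) powr \<alpha>
      + 7 * (1 + 4 * t) powr \<alpha> - 18 * (1 + 6 * t) powr \<alpha> + 6 * (1 + 8 * t) powr \<alpha>
      + 9 * (1 + 9 * t) powr \<alpha> - 6 * (1 + 12 * t) powr \<alpha> + (1 + 16 * t) powr \<alpha>) / t ^ 3"
    using eventually_at_right_less
  proof eventually_elim
    case (elim t)
    have "0 \<le> qform {..<4} (\<lambda>i j. (\<Sum>l<2::nat. (if l = 0 then 1 else t) *
        (if l = 0 then 1 else real i + 1) * (if l = 0 then 1 else real j + 1)) powr \<alpha>)
        (\<lambda>i. [1, -3, 3, -1] ! i)"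
      by (rule gram_powr_qform_nonneg[OF assms(1,2,4) TP_affine]) (use elim in auto)
    then show ?case using elim
      by (intro divide_nonneg_nonneg) (simp_all add: qform_def eval_nat_numeral algebra_simps)
  qed
  then have "0 \<le> 6 * \<alpha> * (\<alpha> - 1) * (\<alpha> - 2)" by (rule tendsto_lowerbound[OF powr_third_difference]) simp
  moreover have "6 * \<alpha> * (\<alpha> - 1) * (\<alpha> - 2) < 0" if "\<alpha> > 1" "\<alpha> < 2"
    using that by (intro mult_pos_neg) auto
  ultimately show ?thesis using assms(3) by force
qed


lemma preserves_TP_symmetric_comp:
  assumes "c > 0" "\<And>x. x > 0 \<Longrightarrow> F x = c * G x"
    and "\<And>a. (\<And>i j. a i j = a j i) \<Longrightarrow> TP a d d \<Longrightarrow> TP (\<lambda>i j. G (a i j)) d d"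
  shows "preserves_TP_symmetric d F"
  unfolding preserves_TP_symmetric_iff
proof (intro allI impI)
  fix a :: "nat \<Rightarrow> nat \<Rightarrow> real" assume a: "\<forall>i j. a i j = a j i" "TP a d d"
  have "TP (\<lambda>i j. G (a i j)) d d" using a by (intro assms(3)) auto
  then have "TP (\<lambda>i j. c * 1 * G (a i j)) d d" by (rule TP_scale) (use assms in simp_all)
  then show "TP (\<lambda>i j. F (a i j)) d d"
    by (rule TP_cong_imp) (use TP_pos[OF a(2)] assms(2) in simp)
qed

section \<open>A negative 4-by-4 minor in size five\<close>

lemma kdet_4_row_ones:
  assumes "\<And>j. j < 4 \<Longrightarrow> f 0 j = 1"
  shows "kdet 4 f = kdet 3 (\<lambda>i j. f (Suc i) (Suc j) - f (Suc i) 0)"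
proof -
  have S: "(\<Sum>j<Suc 3. h j) = h 0 + h 1 + h 2 + h 3" for h :: "nat \<Rightarrow> real"
    by (simp add: eval_nat_numeral)
  have n: "Suc 1 = 2" "Suc 2 = 3" by simp_all
  have "kdet 4 f = kdet (Suc 3) f" by simp
  also have "\<dots> = kdet 3 (\<lambda>i j. f (Suc i) (Suc j) - f (Suc i) 0)"
    unfolding kdet_Suc_first_row S kdet_3 n One_nat_def[symmetric]
    using assms[of 0] assms[of 1] assms[of 2] assms[of 3] by (simp add: algebra_simps)
  finally show ?thesis .
qed

text \<open>The kernel \<open>1 + t * (z i \<bullet> z j)\<close> for five planar points has rank three. Its
  minor on rows \<open>0..3\<close> and columns \<open>1..4\<close> vanishes, and for the points \<open>(0,0)\<close>, \<open>(2,1)\<close>,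
  \<open>(3,2)\<close>, \<open>(6,6)\<close>, \<open>(7,8)\<close> that minor of the entrywise power is negative to leading order in
  \<open>t\<close> as soon as \<open>\<alpha> > 1\<close>. Moving the first point to \<open>(3 * h, h)\<close> makes the columns
  \<open>1\<close>, \<open>u\<close>, \<open>v\<close> totally positive.\<close>

definition planar :: "real \<Rightarrow> nat \<Rightarrow> nat \<Rightarrow> real" where
  "planar h i l = (if l = 0 then 1 else
     if l = 1 then [3 * h, 2, 3, 6, 7] ! i else [h, 1, 2, 6, 8] ! i)"

text \<open>The 2-by-2 minors say that u, v and v/u increase along the points, the 3-by-3 minors
  that the points form a convex chain. The direction (3, 1) of the moved point has slope 1/3, below
  the slope 1/2 of (2, 1).\<close>

lemma TP_planar:
  assumes h: "0 < h" "h < 1 / 4"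
  shows "TP (planar h) 5 3"
proof (rule TP_I_3)
  have i5: "i = 0 \<or> i = 1 \<or> i = 2 \<or> i = 3 \<or> i = 4" if "i < 5" for i :: nat using that by auto
  have j3: "i = 0 \<or> i = 1 \<or> i = 2" if "i < 3" for i :: nat using that by auto
  {
    fix i j :: nat assume "i < 5" "j < 3"
    show "planar h i j > 0"
      using i5[OF \<open>i < 5\<close>] j3[OF \<open>j < 3\<close>]
      by (elim disjE) (use h in \<open>simp_all add: planar_def\<close>)
  next
    fix i k j l :: nat assume *: "i < k" "k < 5" "j < l" "l < 3"
    have "i < 5" "j < 3" using * by simp_all
    show "planar h i l * planar h k j < planar h i j * planar h k l"
      using i5[OF \<open>i < 5\<close>] i5[OF *(2)] j3[OF \<open>j < 3\<close>] j3[OF *(4)]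
      by (elim disjE) (use * h in \<open>simp_all add: planar_def\<close>)
  next
    fix i j k :: nat assume *: "i < j" "j < k" "k < 5"
    have "i = 0 \<and> j = 1 \<and> k = 2 \<or> i = 0 \<and> j = 1 \<and> k = 3 \<or> i = 0 \<and> j = 1 \<and> k = 4 \<or>
      i = 0 \<and> j = 2 \<and> k = 3 \<or> i = 0 \<and> j = 2 \<and> k = 4 \<or> i = 0 \<and> j = 3 \<and> k = 4 \<or>
      i = 1 \<and> j = 2 \<and> k = 3 \<or> i = 1 \<and> j = 2 \<and> k = 4 \<or> i = 1 \<and> j = 3 \<and> k = 4 \<or>
      i = 2 \<and> j = 3 \<and> k = 4"
      using * by presburger
    then show "planar h i 0 * (planar h j 1 * planar h k 2 - planar h j 2 * planar h k 1)
        - planar h i 1 * (planar h j 0 * planar h k 2 - planar h j 2 * planar h k 0)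
        + planar h i 2 * (planar h j 0 * planar h k 1 - planar h j 1 * planar h k 0) > 0"
      by (elim disjE conjE) (use h in \<open>simp_all add: planar_def\<close>)
  }
qed

text \<open>The 4-by-4 minor on rows 0..3 and columns 1..4 after subtracting its first column, with
  \<open>f\<close> applied to the inner products of the points. The first point is the origin, so
  row 0 consists of ones and drops out.\<close>

definition planar_minor :: "(real \<Rightarrow> real) \<Rightarrow> real" where
  "planar_minor f =
     (f 8 - f 5) * ((f 30 - f 8) * (f 90 - f 18) - (f 37 - f 8) * (f 72 - f 18))
     - (f 18 - f 5) * ((f 13 - f 8) * (f 90 - f 18) - (f 37 - f 8) * (f 30 - f 18))
     + (f 22 - f 5) * ((f 13 - f 8) * (f 72 - f 18) - (f 30 - f 8) * (f 30 - f 18))"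

text \<open>The t^4 coefficient is \<alpha>^2 binom(\<alpha>,2) times the sum, over m = u^2, u v,
  v^2 with weights 1, 2, 1, of the determinants with columns 1, u, v, m at the row points and at the
  column points. These are 6, 12, 18 and -4, -2, 2, so the sum is -36.\<close>

lemma powr_planar_minor:
  fixes \<alpha> :: real
  shows "((\<lambda>t. planar_minor (\<lambda>x. (1 + x * t) powr \<alpha>) / t ^ 4) \<longlongrightarrow> - 18 * \<alpha> ^ 3 * (\<alpha> - 1)) (at_right 0)"
  unfolding planar_minor_def by (real_asymp simp: field_simps power3_eq_cube)

lemma preserves_5_exponent:
  assumes F: "preserves_TP_symmetric 5 F" "c > 0" "\<And>x. x > 0 \<Longrightarrow> F x = c * x powr \<alpha>"
    and \<alpha>: "\<alpha> \<ge> 1"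
  shows "\<alpha> = 1"
proof -
  define g where "g t h i j = (\<Sum>l<3. (if l = 0 then 1 else t) * planar h i l * planar h j l)" for t h :: real and i j
  have g: "g t h i j = 1 + t * planar h i 1 * planar h j 1 + t * planar h i 2 * planar h j 2" for t h i j
    by (simp add: g_def eval_nat_numeral planar_def)
  \<comment> \<open>Three limits are taken in turn: first the approximation parameter
    \<open>\<epsilon>\<close>, then \<open>h\<close>, and finally \<open>t\<close>, each preserving
    the weak inequality.\<close>
  have 1: "kdet 4 (\<lambda>i j. g t h i (Suc j) powr \<alpha>) \<ge> 0" if t: "t > 0" and h: "0 < h" "h < 1 / 4" for t h
  proof -
    obtain B where B: "\<And>\<epsilon> i j. \<epsilon> > 0 \<Longrightarrow> B \<epsilon> i j = B \<epsilon> j i" "\<And>\<epsilon>. \<epsilon> > 0 \<Longrightarrow> TP (B \<epsilon>) 5 5"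
      and lim: "\<And>i j. i < 5 \<Longrightarrow> j < 5 \<Longrightarrow> ((\<lambda>\<epsilon>. B \<epsilon> i j) \<longlongrightarrow> g t h i j powr \<alpha>) (at_right (0::real))"
    proof (rule gram_powr_limit[of 5 F c \<alpha> "planar h" 3 "\<lambda>l. if l = 0 then 1 else t"])
      fix B assume "\<And>\<epsilon> i j. \<epsilon> > 0 \<Longrightarrow> B \<epsilon> i j = B \<epsilon> j i" "\<And>\<epsilon>. \<epsilon> > 0 \<Longrightarrow> TP (B \<epsilon>) 5 5"
        "\<And>i j. i < 5 \<Longrightarrow> j < 5 \<Longrightarrow> ((\<lambda>\<epsilon>. B \<epsilon> i j) \<longlongrightarrow>
          (\<Sum>l<3. (if l = 0 then 1 else t) * planar h i l * planar h j l) powr \<alpha>) (at_right (0::real))"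
      then show thesis by (rule that[unfolded g_def])
    qed (use F TP_planar[OF h] t in auto)
    have "((\<lambda>\<epsilon>. kdet 4 (\<lambda>i j. B \<epsilon> i (Suc j))) \<longlongrightarrow> kdet 4 (\<lambda>i j. g t h i (Suc j) powr \<alpha>)) (at_right 0)"
      by (rule tendsto_kdet) (simp add: lim)
    moreover have "\<forall>\<^sub>F \<epsilon> in at_right 0. 0 \<le> kdet 4 (\<lambda>i j. B \<epsilon> i (Suc j))"
      using eventually_at_right_less
    proof eventually_elim
      case (elim \<epsilon>)
      \<comment> \<open>Rows 0..3 against columns 1..4: a non-principal minor of the 5-by-5
        array.\<close>
      have "selects 4 5 (\<lambda>i. i)" "selects 4 5 Suc" by (auto simp: selects_def)
      then show ?case using TP_D[OF B(2)[OF elim]] by (meson less_imp_le)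
    qed
    ultimately show ?thesis by (rule tendsto_lowerbound) simp
  qed
  have 2: "kdet 4 (\<lambda>i j. g t 0 i (Suc j) powr \<alpha>) \<ge> 0" if t: "t > 0" for t
  proof -
    have "((\<lambda>h. kdet 4 (\<lambda>i j. g t h i (Suc j) powr \<alpha>)) \<longlongrightarrow>
        kdet 4 (\<lambda>i j. g t 0 i (Suc j) powr \<alpha>)) (at_right 0)"
    proof (rule tendsto_kdet)
      fix i j :: nat assume ij: "i < 4" "j < 4"
      have l: "((\<lambda>h. planar h i l) \<longlongrightarrow> planar 0 i l) (at_right 0)" for i l
      proof (cases i)
        case 0
        then show ?thesis by (auto simp: planar_def intro!: tendsto_eq_intros)
      next
        case (Suc k)
        then show ?thesis by (simp add: planar_def)
      qed
      have nn: "planar 0 i 1 \<ge> 0" "planar 0 i 2 \<ge> 0" if "i < 5" for i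
        using that by (auto simp: planar_def less_Suc_eq eval_nat_numeral)
      have "g t 0 i (Suc j) > 0"
        unfolding g using t ij nn[of i] nn[of "Suc j"] by (intro add_pos_nonneg) auto
      then show "((\<lambda>h. g t h i (Suc j) powr \<alpha>) \<longlongrightarrow> g t 0 i (Suc j) powr \<alpha>) (at_right 0)"
        unfolding g by (intro tendsto_powr tendsto_intros l) simp
    qed
    moreover have "\<forall>\<^sub>F h in at_right 0. 0 \<le> kdet 4 (\<lambda>i j. g t h i (Suc j) powr \<alpha>)"
      using eventually_at_right_real[of 0 "1 / 4"] by (auto elim!: eventually_mono intro: 1 t)
    ultimately show ?thesis by (rule tendsto_lowerbound) simp
  qed
  have 3: "kdet 4 (\<lambda>i j. g t 0 i (Suc j) powr \<alpha>) = planar_minor (\<lambda>x. (1 + x * t) powr \<alpha>)" for t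
  proof -
    have "kdet 4 (\<lambda>i j. g t 0 i (Suc j) powr \<alpha>) =
        kdet 3 (\<lambda>i j. g t 0 (Suc i) (Suc (Suc j)) powr \<alpha> - g t 0 (Suc i) (Suc 0) powr \<alpha>)"
      by (rule kdet_4_row_ones) (simp add: g planar_def)
    also have "\<dots> = planar_minor (\<lambda>x. (1 + x * t) powr \<alpha>)"
      unfolding kdet_3 planar_minor_def
      by (simp add: g planar_def mult.commute[of t] add.commute[of _ 1])
    finally show ?thesis .
  qed
  have "0 \<le> - 18 * \<alpha> ^ 3 * (\<alpha> - 1)"
  proof (rule tendsto_lowerbound[OF powr_planar_minor])
    show "\<forall>\<^sub>F t in at_right 0. 0 \<le> planar_minor (\<lambda>x. (1 + x * t) powr \<alpha>) / t ^ 4"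
      using eventually_at_right_less by eventually_elim (simp add: 2 3[symmetric])
  qed simp
  moreover have "\<alpha> ^ 3 > 0" using \<alpha> by simp
  ultimately show ?thesis using \<alpha> by (simp add: mult_le_0_iff)
qed

theorem theorem4p9:
  fixes F :: "real \<Rightarrow> real" and d :: nat
  assumes "d \<ge> 1"
  shows "(preserves_TP_symmetric d F \<longleftrightarrow>
            (d = 1 \<longrightarrow> (\<forall>x>0. F x > 0)) \<and>
            (d = 2 \<longrightarrow> (\<forall>x>0. F x > 0) \<and> strict_mono_on {0<..} F \<and> mult_midconvex F) \<and>
            (d = 3 \<longrightarrow> (\<exists>c \<alpha>. c > 0 \<and> \<alpha> \<ge> 1 \<and> (\<forall>x>0. F x = c * x powr \<alpha>))) \<and>
            (d = 4 \<longrightarrow> (\<exists>c \<alpha>. c > 0 \<and> \<alpha> \<in> {1} \<union> {2..} \<and> (\<forall>x>0. F x = c * x powr \<alpha>))) \<and>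
            (d \<ge> 5 \<longrightarrow> (\<exists>c>0. \<forall>x>0. F x = c * x)))
         \<and> ((\<forall>x>0. F x > 0) \<and> strict_mono_on {0<..} F \<and> mult_midconvex F
              \<longrightarrow> continuous_on {0<..} F)"
proof (intro conjI)
  show "(\<forall>x>0. F x > 0) \<and> strict_mono_on {0<..} F \<and> mult_midconvex F
      \<longrightarrow> continuous_on {0<..} F"
    by (simp add: continuous_on_of_mult_midconvex)
  have powr: "\<exists>c \<alpha>. c > 0 \<and> \<alpha> \<ge> 1 \<and> (\<forall>x>0. F x = c * x powr \<alpha>)"
    if "preserves_TP_symmetric n F" "n \<ge> 3" for n
  proof -
    have F3: "preserves_TP_symmetric 3 F" by (rule preserves_TP_symmetric_le[OF that])
    then obtain c \<alpha> where c: "c > 0" "\<alpha> > 0" "\<forall>x>0. F x = c * x powr \<alpha>"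
      using preserves_3_powr by blast
    then have "\<alpha> \<ge> 1" by (intro preserves_3_exponent[OF F3 c(1,2)]) simp
    then show ?thesis using c by blast
  qed
  consider "d = 1" | "d = 2" | "d = 3" | "d = 4" | "d \<ge> 5" using assms by linarith
  then show "preserves_TP_symmetric d F \<longleftrightarrow>
            (d = 1 \<longrightarrow> (\<forall>x>0. F x > 0)) \<and>
            (d = 2 \<longrightarrow> (\<forall>x>0. F x > 0) \<and> strict_mono_on {0<..} F \<and> mult_midconvex F) \<and>
            (d = 3 \<longrightarrow> (\<exists>c \<alpha>. c > 0 \<and> \<alpha> \<ge> 1 \<and> (\<forall>x>0. F x = c * x powr \<alpha>))) \<and>
            (d = 4 \<longrightarrow> (\<exists>c \<alpha>. c > 0 \<and> \<alpha> \<in> {1} \<union> {2..} \<and> (\<forall>x>0. F x = c * x powr \<alpha>))) \<and>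
            (d \<ge> 5 \<longrightarrow> (\<exists>c>0. \<forall>x>0. F x = c * x))"
  proof cases
    case 1
    then show ?thesis using preserves_1_iff[of F] by simp
  next
    case 2
    then show ?thesis using preserves_2_iff[of F] by simp
  next
    case 3
    have "preserves_TP_symmetric 3 F \<longleftrightarrow> (\<exists>c \<alpha>. c > 0 \<and> \<alpha> \<ge> 1 \<and> (\<forall>x>0. F x = c * x powr \<alpha>))"
    proof
      assume "\<exists>c \<alpha>. c > 0 \<and> \<alpha> \<ge> 1 \<and> (\<forall>x>0. F x = c * x powr \<alpha>)"
      then obtain c \<alpha> where c: "c > 0" "\<alpha> \<ge> 1" "\<forall>x>0. F x = c * x powr \<alpha>" by blast
      show "preserves_TP_symmetric 3 F"
        by (rule preserves_TP_symmetric_comp[OF c(1), where G = "\<lambda>x. x powr \<alpha>"])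
          (use c in \<open>simp_all add: TP_powr_3\<close>)
    next
      assume "preserves_TP_symmetric 3 F"
      then show "\<exists>c \<alpha>. c > 0 \<and> \<alpha> \<ge> 1 \<and> (\<forall>x>0. F x = c * x powr \<alpha>)" by (rule powr) simp
    qed
    then show ?thesis using 3 by simp
  next
    case 4
    have "preserves_TP_symmetric 4 F \<longleftrightarrow>
        (\<exists>c \<alpha>. c > 0 \<and> \<alpha> \<in> {1} \<union> {2..} \<and> (\<forall>x>0. F x = c * x powr \<alpha>))"
    proof
      assume F: "preserves_TP_symmetric 4 F"
      then obtain c \<alpha> where c: "c > 0" "\<alpha> \<ge> 1" "\<forall>x>0. F x = c * x powr \<alpha>"
        using powr[of 4] by auto
      have "\<alpha> = 1 \<or> \<alpha> \<ge> 2" by (rule preserves_4_exponent[OF F c(1,2)]) (simp add: c(3))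
      then show "\<exists>c \<alpha>. c > 0 \<and> \<alpha> \<in> {1} \<union> {2..} \<and> (\<forall>x>0. F x = c * x powr \<alpha>)"
        using c by auto
    next
      assume "\<exists>c \<alpha>. c > 0 \<and> \<alpha> \<in> {1} \<union> {2..} \<and> (\<forall>x>0. F x = c * x powr \<alpha>)"
      then obtain c \<alpha> where c: "c > 0" "\<alpha> = 1 \<or> \<alpha> \<ge> 2" "\<forall>x>0. F x = c * x powr \<alpha>" by auto
      from c(2) show "preserves_TP_symmetric 4 F"
      proof
        assume "\<alpha> = 1"
        then show ?thesis using c by (intro preserves_TP_symmetric_comp[of c _ "\<lambda>x. x"]) simp_all
      next
        assume "\<alpha> \<ge> 2"
        then show ?thesis
          by (intro preserves_TP_symmetric_comp[OF c(1), where G = "\<lambda>x. x powr \<alpha>"] TP_powr_4)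
            (simp_all add: c(3))
      qed
    qed
    then show ?thesis using 4 by simp
  next
    case 5
    have "preserves_TP_symmetric d F \<longleftrightarrow> (\<exists>c>0. \<forall>x>0. F x = c * x)"
    proof
      assume F: "preserves_TP_symmetric d F"
      obtain c \<alpha> where c: "c > 0" "\<alpha> \<ge> 1" "\<forall>x>0. F x = c * x powr \<alpha>"
        using powr[OF F] 5 by auto
      have "\<alpha> = 1"
        by (rule preserves_5_exponent[OF preserves_TP_symmetric_le[OF F 5] c(1) _ c(2)])
          (simp add: c(3))
      then show "\<exists>c>0. \<forall>x>0. F x = c * x" using c by auto
    next
      assume "\<exists>c>0. \<forall>x>0. F x = c * x"
      then obtain c where "c > 0" "\<forall>x>0. F x = c * x" by blast
      then show "preserves_TP_symmetric d F"
        by (intro preserves_TP_symmetric_comp[of c _ "\<lambda>x. x"]) simp_all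
    qed
    then show ?thesis using 5 by simp
  qed
qed

end
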